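(* Let $p$ be a fixed prime and let $H$ and $K$ be finite $p$-groups. Then $\delta(H\times K)=\delta(H)+\delta(K)$.
   Context: All groups are finite and all representations are over $\mathbb{C}$. For a group $G$, the representation dimension $\delta(G)$ is the least dimension of a faithful (not necessarily irreducible) complex representation of $G$, i.e. the smallest positive integer $n$ such that $G$ embeds into $\mathrm{GL}_n(\mathbb{C})$.
   Formalization: The representation dimension is taken as the least non-negative (not positive) integer n, so the trivial group has dimension 0; with the positive convention the claim fails when H or K is trivial, and for nontrivial groups the two definitions agree. *)

theory Defs
  imports Jordan_Normal_Form.Matrix "HOL-Algebra.Coset" "HOL-Computational_Algebra.Primes" Complex_Main
begin

definition GL :: "nat \<Rightarrow> complex mat monoid" where
  "GL n = units_of (ring_mat TYPE(complex) n ())"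

lemma carrier_GL: "carrier (GL n) = {A \<in> carrier_mat n n. invertible_mat A}"
proof -
  have "invertible_mat A \<longleftrightarrow> (\<exists>B \<in> carrier_mat n n. B * A = 1\<^sub>m n \<and> A * B = 1\<^sub>m n)"
    if A: "A \<in> carrier_mat n n" for A :: "complex mat"
  proof
    assume "invertible_mat A"
    then obtain B where B: "A * B = 1\<^sub>m n" "B * A = 1\<^sub>m (dim_row B)"
      using A by (auto simp: invertible_mat_def inverts_mat_def)
    have "dim_col B = n"
      using arg_cong[OF B(1), of dim_col] by simp
    moreover have "dim_row B = n"
      using arg_cong[OF B(2), of dim_col] A by simp
    ultimately show "\<exists>B \<in> carrier_mat n n. B * A = 1\<^sub>m n \<and> A * B = 1\<^sub>m n"
      using B by (intro bexI[of _ B]) auto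
  next
    assume "\<exists>B \<in> carrier_mat n n. B * A = 1\<^sub>m n \<and> A * B = 1\<^sub>m n"
    then show "invertible_mat A"
      using A by (auto simp: invertible_mat_def inverts_mat_def square_mat.simps)
  qed
  then show ?thesis
    by (auto simp: GL_def units_of_def Units_def ring_mat_simps)
qed

lemma mult_GL: "A \<otimes>\<^bsub>GL n\<^esub> B = A * B"
  by (simp add: GL_def units_of_def ring_mat_simps)

lemma one_GL: "\<one>\<^bsub>GL n\<^esub> = 1\<^sub>m n"
  by (simp add: GL_def units_of_def ring_mat_simps)

lemma group_GL: "group (GL n)"
proof -
  interpret semiring "ring_mat TYPE(complex) n ()" by (rule semiring_mat)
  show ?thesis unfolding GL_def by (rule units_group)
qed

definition faithful_rep :: "('a, 'b) monoid_scheme \<Rightarrow> nat \<Rightarrow> ('a \<Rightarrow> complex mat) \<Rightarrow> bool" where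
  "faithful_rep G n \<rho> \<longleftrightarrow> \<rho> \<in> mon G (GL n)"

text \<open>
  The zero-dimensional representation is admitted. It is faithful exactly for the trivial
  group, which therefore has representation dimension 0; for every other group the minimum
  is automatically taken over positive dimensions (see \<open>rep_dim_eq_Least_pos\<close>).
\<close>

definition rep_dim :: "('a, 'b) monoid_scheme \<Rightarrow> nat" where
  "rep_dim G = (LEAST n. \<exists>\<rho>. faithful_rep G n \<rho>)"

lemma rep_dim_eq_Least_pos:
  fixes G (structure)
  assumes "carrier G \<noteq> {\<one>}" and "group G"
  shows "rep_dim G = (LEAST n. n > 0 \<and> (\<exists>\<rho>. faithful_rep G n \<rho>))"
proof -
  interpret group G by fact
  have "\<not> faithful_rep G 0 \<rho>" for \<rho>
  proof
    assume "faithful_rep G 0 \<rho>"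
    then have hom: "\<rho> \<in> hom G (GL 0)" and inj: "inj_on \<rho> (carrier G)"
      by (auto simp: faithful_rep_def mon_def)
    have "x = \<one>" if x: "x \<in> carrier G" for x
    proof -
      have "\<rho> x \<in> carrier_mat 0 0" "\<rho> \<one> \<in> carrier_mat 0 0"
        using hom x by (auto simp: hom_def carrier_GL)
      then have "\<rho> x = \<rho> \<one>" by (intro eq_matI) auto
      with inj x show ?thesis by (auto dest: inj_onD)
    qed
    with assms(1) show False by auto
  qed
  then have "(\<exists>\<rho>. faithful_rep G n \<rho>) \<longleftrightarrow> n > 0 \<and> (\<exists>\<rho>. faithful_rep G n \<rho>)" for n
    by (metis neq0_conv)
  then have "(\<lambda>n. \<exists>\<rho>. faithful_rep G n \<rho>) = (\<lambda>n. n > 0 \<and> (\<exists>\<rho>. faithful_rep G n \<rho>))"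
    by (rule ext)
  then show ?thesis by (simp only: rep_dim_def)
qed

lemma rep_dim_trivial:
  fixes G (structure)
  assumes "carrier G = {\<one>}" and "group G"
  shows "rep_dim G = 0"
proof -
  have "1\<^sub>m 0 \<in> carrier (GL 0)"
    using monoid.one_closed[OF group.is_monoid[OF group_GL]] by (simp add: one_GL)
  then have "(\<lambda>_. 1\<^sub>m 0) \<in> mon G (GL 0)"
    using assms(1) by (auto simp: mon_def hom_def mult_GL inj_on_def)
  then show ?thesis
    unfolding rep_dim_def faithful_rep_def by (intro Least_equality) auto
qed

definition finite_p_group :: "nat \<Rightarrow> ('a, 'b) monoid_scheme \<Rightarrow> bool" where
  "finite_p_group p G \<longleftrightarrow> group G \<and> finite (carrier G) \<and> (\<exists>k. Coset.order G = p ^ k)"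

end

theory Submission
  imports Defs "Jordan_Normal_Form.Determinant" "HOL-Algebra.Group_Action" "HOL-Algebra.Multiplicative_Group"
begin

text \<open>
  The upper bound is given by block diagonal matrices. For the lower bound, let \<open>U\<close> and \<open>W\<close> be the
  groups of central elements of order dividing \<open>p\<close> in \<open>H\<close> and \<open>K\<close>, and let \<open>\<rho>\<close> be a faithful
  representation of \<open>H \<times> K\<close> of dimension \<open>n\<close>. Since \<open>U \<times> W\<close> is central, \<open>\<rho>\<close> splits into the
  eigenspaces \<open>V\<^sub>\<phi>\<close> of a finite set \<open>X\<close> of characters of \<open>U \<times> W\<close>, and \<open>X\<close> separates the points of
  \<open>U \<times> W\<close>. For \<open>A \<subseteq> X\<close> let \<open>p ^ a A\<close> and \<open>p ^ b A\<close> be the sizes of the common kernels of \<open>A\<close> in \<open>U\<close>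
  and in \<open>W\<close>. Then \<open>a A + b A \<le> card (X - A)\<close>, and \<open>a\<close> and \<open>b\<close> are supermodular, so matroid union
  yields a subset \<open>J\<close> with \<open>a J = b (X - J) = 0\<close>. As a nontrivial normal subgroup of a \<open>p\<close>-group
  contains a nontrivial central element of order \<open>p\<close>, the sum of the \<open>V\<^sub>\<phi>\<close> over \<open>J\<close> is faithful for
  \<open>H\<close> and the sum over \<open>X - J\<close> is faithful for \<open>K\<close>; their dimensions add up to \<open>n\<close>.
\<close>

section \<open>Partitions for two submodular functions\<close>

text \<open>
  This is the hard direction of the matroid union theorem. One of the two contractions, of
  \<open>f\<close> or of \<open>g\<close> by \<open>x\<close>, inherits the hypothesis: violating sets \<open>A\<close> and \<open>B\<close> for both would,
  by submodularity, violate it at \<open>insert x (A \<union> B)\<close> or at \<open>A \<inter> B\<close>.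
\<close>

lemma submodular_partition:
  fixes f g :: "'x set \<Rightarrow> int"
  assumes "finite X"
    and "\<And>A B. A \<subseteq> X \<Longrightarrow> B \<subseteq> X \<Longrightarrow> f (A \<union> B) + f (A \<inter> B) \<le> f A + f B"
    and "\<And>A B. A \<subseteq> X \<Longrightarrow> B \<subseteq> X \<Longrightarrow> g (A \<union> B) + g (A \<inter> B) \<le> g A + g B"
    and "\<And>A. A \<subseteq> X \<Longrightarrow> d \<le> f A + g A + int (card (X - A))"
  shows "\<exists>J\<subseteq>X. d \<le> f J + g (X - J)"
  using assms
proof (induction X arbitrary: f g rule: finite_induct)
  case empty
  then show ?case by force
next
  case (insert x X)
  note x = \<open>x \<notin> X\<close> and fin = \<open>finite X\<close>
  note f = insert.prems(1) and g = insert.prems(2) and d = insert.prems(3)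
  show ?case
  \<comment> \<open>Contracting \<open>f\<close> by \<open>x\<close> commits \<open>x\<close> to
    \<open>J\<close>; contracting \<open>g\<close> by \<open>x\<close> commits it to the complement
    of \<open>J\<close>.\<close>
  proof (cases "\<forall>A\<subseteq>X. d \<le> f (insert x A) + g A + int (card (X - A))")
    case True
    have "\<exists>J\<subseteq>X. d \<le> f (insert x J) + g (X - J)"
    proof (rule insert.IH)
      fix A B assume "A \<subseteq> X" "B \<subseteq> X"
      then show "f (insert x (A \<union> B)) + f (insert x (A \<inter> B)) \<le> f (insert x A) + f (insert x B)"
        using f[of "insert x A" "insert x B"] by (auto simp: subset_insertI2)
      show "g (A \<union> B) + g (A \<inter> B) \<le> g A + g B"
        using g \<open>A \<subseteq> X\<close> \<open>B \<subseteq> X\<close> by blast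
    qed (use True in blast)
    then obtain J where "J \<subseteq> X" "d \<le> f (insert x J) + g (X - J)" by blast
    moreover have "insert x X - insert x J = X - J" using x by blast
    ultimately show ?thesis by (intro exI[of _ "insert x J"]) auto
  next
    case False
    then obtain A where A: "A \<subseteq> X" "f (insert x A) + g A + int (card (X - A)) < d"
      by (auto simp: not_le)
    have *: "d \<le> f B + g (insert x B) + int (card (X - B))" if B: "B \<subseteq> X" for B
    proof (rule ccontr)
      assume less: "\<not> ?thesis"
      have "insert x A \<union> B = insert x (A \<union> B)" "insert x A \<inter> B = A \<inter> B"
        "A \<union> insert x B = insert x (A \<union> B)" "A \<inter> insert x B = A \<inter> B"
        using x A(1) B by auto
      then have "f (insert x (A \<union> B)) + f (A \<inter> B) \<le> f (insert x A) + f B"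
        "g (insert x (A \<union> B)) + g (A \<inter> B) \<le> g A + g (insert x B)"
        using f[of "insert x A" B] g[of A "insert x B"] A(1) B by (auto simp: subset_insertI2)
      moreover have "d \<le> f (insert x (A \<union> B)) + g (insert x (A \<union> B)) + int (card (X - (A \<union> B)))"
        using d[of "insert x (A \<union> B)"] A(1) B x by (auto simp: subset_insertI2)
      \<comment> \<open>The extra 1 arises because \<open>x\<close> lies outside
        \<open>A \<inter> B\<close>, so the complement in \<open>insert x X\<close> has one more
        element. The contradiction survives: two strict violations between integers gain 2.\<close>
      moreover have "d \<le> f (A \<inter> B) + g (A \<inter> B) + int (card (X - A \<inter> B)) + 1"
      proof -
        have "card (insert x X - A \<inter> B) = Suc (card (X - A \<inter> B))"
          using x fin A(1) by (subst insert_Diff_if) auto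
        then show ?thesis using d[of "A \<inter> B"] A(1) by force
      qed
      moreover have "card (X - (A \<union> B)) + card (X - A \<inter> B) = card (X - A) + card (X - B)"
        using card_Un_Int[of "X - A" "X - B"] fin by (simp add: Diff_Un Diff_Int)
      ultimately show False using less A(2) by linarith
    qed
    have "\<exists>J\<subseteq>X. d \<le> f J + g (insert x (X - J))"
    proof -
      have "\<exists>J\<subseteq>X. d \<le> f J + (\<lambda>S. g (insert x S)) (X - J)"
      proof (rule insert.IH)
        fix A B assume "A \<subseteq> X" "B \<subseteq> X"
        then show "g (insert x (A \<union> B)) + g (insert x (A \<inter> B)) \<le> g (insert x A) + g (insert x B)"
          using g[of "insert x A" "insert x B"] by (auto simp: subset_insertI2)
        show "f (A \<union> B) + f (A \<inter> B) \<le> f A + f B"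
          using f \<open>A \<subseteq> X\<close> \<open>B \<subseteq> X\<close> by blast
      qed (use * in blast)
      then show ?thesis .
    qed
    then obtain J where J: "J \<subseteq> X" "d \<le> f J + g (insert x (X - J))" by blast
    moreover have "insert x X - J = insert x (X - J)" using J(1) x by blast
    ultimately show ?thesis by (intro exI[of _ J]) auto
  qed
qed

section \<open>Counting products of two subgroups\<close>

text \<open>Multiplication maps \<open>P \<times> Q\<close> into \<open>R\<close>, and each fibre
  injects into \<open>P \<inter> Q\<close>: relative to a base point \<open>(a, b)\<close> of the
  fibre, a pair \<open>(x, y)\<close> is recovered from
  \<open>inv a \<otimes> x = b \<otimes> inv y\<close>, which lies in both subgroups. Taking
  exponents of \<open>p\<close>, this becomes supermodularity of the kernel sizes.\<close>

lemma (in group) card_mult_subgroups_le: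
  assumes P: "subgroup P G" and Q: "subgroup Q G" and R: "subgroup R G"
    and "P \<subseteq> R" "Q \<subseteq> R" and fin: "finite R"
  shows "card P * card Q \<le> card (P \<inter> Q) * card R"
proof -
  let ?fib = "\<lambda>z. {xy \<in> P \<times> Q. fst xy \<otimes> snd xy = z}"
  have finP: "finite P" using fin \<open>P \<subseteq> R\<close> by (rule rev_finite_subset)
  have fib: "card (?fib z) \<le> card (P \<inter> Q)" for z
  proof (cases "?fib z = {}")
    case False
    then obtain a b where ab: "a \<in> P" "b \<in> Q" "a \<otimes> b = z" by auto
    have inP: "x \<in> carrier G" if "x \<in> P" for x using that subgroup.subset[OF P] by blast
    have inQ: "x \<in> carrier G" if "x \<in> Q" for x using that subgroup.subset[OF Q] by blast
    have eq: "inv a \<otimes> x = b \<otimes> inv y" if "x \<in> P" "y \<in> Q" "x \<otimes> y = z" for x y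
    proof -
      have "inv a \<otimes> x = inv a \<otimes> (x \<otimes> y) \<otimes> inv y"
        using inP[OF that(1)] inQ[OF that(2)] inP[OF ab(1)] by (simp add: m_assoc)
      also have "\<dots> = inv a \<otimes> (a \<otimes> b) \<otimes> inv y" using that ab by simp
      also have "\<dots> = b \<otimes> inv y" using inP[OF ab(1)] inQ[OF ab(2)] inQ[OF that(2)] by (simp add: m_assoc[symmetric])
      finally show ?thesis .
    qed
    have "inj_on (\<lambda>xy. inv a \<otimes> fst xy) (?fib z)"
    proof (rule inj_onI)
      fix u v assume uv: "u \<in> ?fib z" "v \<in> ?fib z" "inv a \<otimes> fst u = inv a \<otimes> fst v"
      then have "fst u = fst v" using ab inP by (auto simp del: Units_l_cancel simp: Units_l_cancel[OF inv_closed[OF inP[OF ab(1)], folded Units_eq]])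
      moreover from this have "snd u = snd v" using uv inP inQ
        by (metis (mono_tags, lifting) Units_eq Units_l_cancel mem_Collect_eq mem_Times_iff)
      ultimately show "u = v" by (rule prod_eqI)
    qed
    moreover have "(\<lambda>xy. inv a \<otimes> fst xy) ` ?fib z \<subseteq> P \<inter> Q"
    proof (rule image_subsetI)
      fix u assume u: "u \<in> ?fib z"
      then have "inv a \<otimes> fst u = b \<otimes> inv (snd u)" using eq[of "fst u" "snd u"] by auto
      moreover have "inv a \<otimes> fst u \<in> P" "b \<otimes> inv (snd u) \<in> Q"
        using u ab P Q by (auto intro!: subgroup.m_closed subgroup.m_inv_closed)
      ultimately show "inv a \<otimes> fst u \<in> P \<inter> Q" by simp
    qed
    ultimately show ?thesis using finP by (meson card_inj_on_le finite_Int)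
  next
    case True
    show ?thesis unfolding True by simp
  qed
  have "card P * card Q = card (P \<times> Q)" by (simp add: card_cartesian_product)
  also have "P \<times> Q = (\<Union>z\<in>R. ?fib z)"
    using subgroup.m_closed[OF R] \<open>P \<subseteq> R\<close> \<open>Q \<subseteq> R\<close> by (auto simp: subset_iff)
  also have "card \<dots> \<le> (\<Sum>z\<in>R. card (?fib z))"
    by (rule card_UN_le[OF fin])
  also have "\<dots> \<le> (\<Sum>z\<in>R. card (P \<inter> Q))" by (rule sum_mono) (rule fib)
  finally show ?thesis by (simp add: mult.commute)
qed

section \<open>Simultaneous diagonalization\<close>

text \<open>There are fewer \<open>i\<close>-th than \<open>p\<close>-th roots of unity, so some
  \<open>p\<close>-th root \<open>w\<close> has \<open>w ^ i \<noteq> 1\<close>. Multiplication by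
  \<open>w\<close> permutes the roots but scales the sum by
  \<open>(1 / w) ^ i \<noteq> 1\<close>.\<close>

lemma sum_roots_unity_power:
  assumes "0 < i" "i < p"
  shows "(\<Sum>z | z ^ p = 1. (1 / z :: complex) ^ i) = 0"
proof -
  have "card {z::complex. z ^ i = 1} < card {z::complex. z ^ p = 1}"
    using assms by (simp add: card_roots_unity_eq)
  moreover have "finite {z::complex. z ^ i = 1}" using assms by (intro finite_roots_unity) auto
  ultimately have "\<not> {z::complex. z ^ p = 1} \<subseteq> {z. z ^ i = 1}"
    using card_mono leD by blast
  then obtain w :: complex where w: "w ^ p = 1" "w ^ i \<noteq> 1" by blast
  then have w0: "w \<noteq> 0" using assms by (metis power_0_left zero_neq_one gr_implies_not_zero)
  let ?S = "\<Sum>z | z ^ p = 1. (1 / z :: complex) ^ i"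
  have "bij_betw ((*) w) {z. z ^ p = 1} {z. z ^ p = 1}"
    by (rule bij_betwI[where g = "\<lambda>z. z / w"])
       (use w w0 in \<open>auto simp: power_mult_distrib power_divide\<close>)
  then have "?S = (\<Sum>z | z ^ p = 1. (1 / (w * z)) ^ i)"
    by (rule sum.reindex_bij_betw[symmetric])
  also have "\<dots> = (1 / w) ^ i * ?S"
    by (simp add: sum_distrib_left power_mult_distrib power_divide)
  finally have "((1 / w) ^ i - 1) * ?S = 0" by (simp add: algebra_simps)
  moreover have "(1 / w) ^ i \<noteq> 1" using w w0 by (simp add: power_divide)
  ultimately show ?thesis by simp
qed

text \<open>If \<open>M ^ p = 1\<close>, this is the projection onto the eigenspace of \<open>M\<close> for the \<open>p\<close>-th root of unity \<open>z\<close>.\<close>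

definition root_proj :: "nat \<Rightarrow> complex mat \<Rightarrow> complex \<Rightarrow> complex mat" where
  "root_proj p M z = mat (dim_row M) (dim_row M)
     (\<lambda>(a, b). (\<Sum>i<p. (1 / z) ^ i * (M ^\<^sub>m i) $$ (a, b)) / of_nat p)"

lemma root_proj_carrier [simp]:
  "M \<in> carrier_mat n n \<Longrightarrow> root_proj p M z \<in> carrier_mat n n"
  by (auto simp: root_proj_def)

lemma index_mult_mat_sum:
  assumes "A \<in> carrier_mat m n" "B \<in> carrier_mat n l" "a < m" "b < l"
  shows "(A * B) $$ (a, b) = (\<Sum>k<n. A $$ (a, k) * B $$ (k, b))"
  using assms by (auto simp: scalar_prod_def atLeast0LessThan intro!: sum.cong)

lemma mult_root_proj:
  assumes M: "M \<in> carrier_mat n n" and N: "N \<in> carrier_mat m n" and "a < m" "b < n"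
  shows "(N * root_proj p M z) $$ (a, b) = (\<Sum>i<p. (1 / z) ^ i * (N * M ^\<^sub>m i) $$ (a, b)) / of_nat p"
proof -
  have "(N * root_proj p M z) $$ (a, b)
      = (\<Sum>k<n. N $$ (a, k) * ((\<Sum>i<p. (1 / z) ^ i * (M ^\<^sub>m i) $$ (k, b)) / of_nat p))"
    using assms by (subst index_mult_mat_sum[OF N root_proj_carrier[OF M]])
      (auto simp: root_proj_def intro!: sum.cong)
  also have "\<dots> = (\<Sum>k<n. \<Sum>i<p. (1 / z) ^ i * (N $$ (a, k) * (M ^\<^sub>m i) $$ (k, b))) / of_nat p"
    by (simp add: sum_distrib_left sum_divide_distrib mult_ac)
  also have "\<dots> = (\<Sum>i<p. \<Sum>k<n. (1 / z) ^ i * (N $$ (a, k) * (M ^\<^sub>m i) $$ (k, b))) / of_nat p"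
    by (subst sum.swap) simp
  also have "\<dots> = (\<Sum>i<p. (1 / z) ^ i * (N * M ^\<^sub>m i) $$ (a, b)) / of_nat p"
    using assms by (subst index_mult_mat_sum[OF N pow_carrier_mat[OF M]])
      (auto simp: sum_distrib_left)
  finally show ?thesis .
qed

lemma root_proj_mult:
  assumes M: "M \<in> carrier_mat n n" and N: "N \<in> carrier_mat n m" and "a < n" "b < m"
  shows "(root_proj p M z * N) $$ (a, b) = (\<Sum>i<p. (1 / z) ^ i * (M ^\<^sub>m i * N) $$ (a, b)) / of_nat p"
proof -
  have "(root_proj p M z * N) $$ (a, b)
      = (\<Sum>k<n. ((\<Sum>i<p. (1 / z) ^ i * (M ^\<^sub>m i) $$ (a, k)) / of_nat p) * N $$ (k, b))"
    using assms by (subst index_mult_mat_sum[OF root_proj_carrier[OF M] N])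
      (auto simp: root_proj_def intro!: sum.cong)
  also have "\<dots> = (\<Sum>k<n. \<Sum>i<p. (1 / z) ^ i * ((M ^\<^sub>m i) $$ (a, k) * N $$ (k, b))) / of_nat p"
    by (simp add: sum_distrib_left sum_distrib_right sum_divide_distrib mult_ac)
  also have "\<dots> = (\<Sum>i<p. \<Sum>k<n. (1 / z) ^ i * ((M ^\<^sub>m i) $$ (a, k) * N $$ (k, b))) / of_nat p"
    by (subst sum.swap) simp
  also have "\<dots> = (\<Sum>i<p. (1 / z) ^ i * (M ^\<^sub>m i * N) $$ (a, b)) / of_nat p"
    using assms by (subst index_mult_mat_sum[OF pow_carrier_mat[OF M] N])
      (auto simp: sum_distrib_left)
  finally show ?thesis .
qed

lemma mult_pow_mat_comm:
  assumes M: "(M :: 'a :: semiring_1 mat) \<in> carrier_mat n n" and N: "N \<in> carrier_mat n n"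
    and "N * M = M * N"
  shows "N * M ^\<^sub>m i = M ^\<^sub>m i * N"
proof (induction i)
  case 0
  then show ?case using M N by simp
next
  case (Suc i)
  have "N * M ^\<^sub>m Suc i = N * M ^\<^sub>m i * M" using M N by (simp add: assoc_mult_mat[of _ n n _ n _ n])
  also have "\<dots> = M ^\<^sub>m i * (N * M)" using Suc M N by (simp add: assoc_mult_mat[of _ n n _ n _ n])
  also have "\<dots> = M ^\<^sub>m Suc i * N" using assms by (simp add: assoc_mult_mat[of _ n n _ n _ n])
  finally show ?case .
qed

lemma root_proj_comm:
  assumes M: "M \<in> carrier_mat n n" and N: "N \<in> carrier_mat n n" and "N * M = M * N"
  shows "N * root_proj p M z = root_proj p M z * N"
proof (rule eq_matI)
  fix a b assume "a < dim_row (root_proj p M z * N)" "b < dim_col (root_proj p M z * N)"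
  then have ab: "a < n" "b < n" using M N by (auto simp: root_proj_def)
  show "(N * root_proj p M z) $$ (a, b) = (root_proj p M z * N) $$ (a, b)"
    unfolding mult_root_proj[OF M N ab] root_proj_mult[OF M N ab] mult_pow_mat_comm[OF assms] ..
qed (use M N in \<open>auto simp: root_proj_def\<close>)

lemma sum_shift_periodic:
  fixes t :: "nat \<Rightarrow> 'a :: ab_group_add"
  assumes "t p = t 0"
  shows "(\<Sum>i<p. t (Suc i)) = (\<Sum>i<p. t i)"
proof -
  have "(\<Sum>i<p. t i) + t p = t 0 + (\<Sum>i<p. t (Suc i))"
    using sum.lessThan_Suc_shift[of t p] by (simp add: add.commute)
  then show ?thesis using assms by (simp add: add.commute)
qed

text \<open>Multiplying by \<open>M\<close> shifts the index of the average by one, at the cost of a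
  factor \<open>z\<close>. As \<open>M ^\<^sub>m p\<close> and \<open>z ^ p\<close> are both 1, the
  terms are periodic and the shifted sum is the original one.\<close>

lemma root_proj_eigen:
  assumes M: "M \<in> carrier_mat n n" and Mp: "M ^\<^sub>m p = 1\<^sub>m n" and z: "z ^ p = 1" and "0 < p"
  shows "M * root_proj p M z = z \<cdot>\<^sub>m root_proj p M z"
proof (rule eq_matI)
  fix a b assume "a < dim_row (z \<cdot>\<^sub>m root_proj p M z)" "b < dim_col (z \<cdot>\<^sub>m root_proj p M z)"
  then have ab: "a < n" "b < n" using M by (auto simp: root_proj_def)
  let ?t = "\<lambda>i. (1 / z) ^ i * (M ^\<^sub>m i) $$ (a, b)"
  have z0: "z \<noteq> 0" using z assms(4) by (metis power_0_left zero_neq_one gr_implies_not_zero)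
  have Msuc: "M * M ^\<^sub>m i = M ^\<^sub>m Suc i" for i
    using mult_pow_mat_comm[OF M M refl] by simp
  have "(M * root_proj p M z) $$ (a, b) = (\<Sum>i<p. (1 / z) ^ i * (M ^\<^sub>m Suc i) $$ (a, b)) / of_nat p"
    using mult_root_proj[OF M M ab] by (simp add: Msuc del: pow_mat.simps)
  also have "(\<Sum>i<p. (1 / z) ^ i * (M ^\<^sub>m Suc i) $$ (a, b)) = z * (\<Sum>i<p. ?t (Suc i))"
    using z0 by (simp add: sum_distrib_left mult.assoc[symmetric] del: pow_mat.simps)
  also have "(\<Sum>i<p. ?t (Suc i)) = (\<Sum>i<p. ?t i)"
  proof -
    have "?t p = ?t 0" using Mp z M by (simp add: power_divide)
    then show ?thesis by (rule sum_shift_periodic)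
  qed
  finally show "(M * root_proj p M z) $$ (a, b) = (z \<cdot>\<^sub>m root_proj p M z) $$ (a, b)"
    using M ab by (simp add: root_proj_def)
qed (use M in \<open>auto simp: root_proj_def\<close>)

lemma pow_mat_eigen:
  assumes M: "(M :: 'a :: comm_ring_1 mat) \<in> carrier_mat n n" and V: "V \<in> carrier_mat n m"
    and MV: "M * V = z \<cdot>\<^sub>m V"
  shows "M ^\<^sub>m i * V = z ^ i \<cdot>\<^sub>m V"
proof (induction i)
  case 0
  then show ?case using M V by auto
next
  case (Suc i)
  have "M ^\<^sub>m Suc i * V = M ^\<^sub>m i * (M * V)"
    using M V by (simp add: assoc_mult_mat[of _ n n _ n _ m])
  also have "\<dots> = z \<cdot>\<^sub>m (M ^\<^sub>m i * V)" unfolding MV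
    using M V by (intro mult_smult_distrib) auto
  also have "\<dots> = z ^ Suc i \<cdot>\<^sub>m V" unfolding Suc by auto
  finally show ?case .
qed

text \<open>On eigenvectors for \<open>z\<close> each of the \<open>p\<close> averaged terms acts as
  the identity. With \<open>V\<close> the projection itself this yields idempotence.\<close>

lemma root_proj_fixes:
  assumes M: "M \<in> carrier_mat n n" and V: "V \<in> carrier_mat n m"
    and MV: "M * V = z \<cdot>\<^sub>m V" and z: "z ^ p = 1" and "0 < p"
  shows "root_proj p M z * V = V"
proof (rule eq_matI)
  fix a b assume "a < dim_row V" "b < dim_col V"
  then have ab: "a < n" "b < m" using V by auto
  have z0: "z \<noteq> 0" using z assms(5) by (metis power_0_left zero_neq_one gr_implies_not_zero)
  show "(root_proj p M z * V) $$ (a, b) = V $$ (a, b)"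
    unfolding root_proj_mult[OF M V ab] pow_mat_eigen[OF M V MV]
    using V ab z0 assms(5) by (simp add: power_divide)
qed (use M V in \<open>auto simp: root_proj_def\<close>)

text \<open>Completeness of the eigenprojections: summing over \<open>z\<close> first, only the term
  \<open>i = 0\<close> survives. The left factor \<open>N\<close> allows a given projection to be
  decomposed along the eigenspaces of \<open>M\<close>.\<close>

lemma sum_mult_root_proj:
  assumes M: "M \<in> carrier_mat n n" and N: "N \<in> carrier_mat m n" and "0 < p" and ab: "a < m" "b < n"
  shows "(\<Sum>z | z ^ p = 1. (N * root_proj p M z) $$ (a, b)) = N $$ (a, b)"
proof -
  have "(\<Sum>z | z ^ p = 1. (N * root_proj p M z) $$ (a, b))
    = (\<Sum>z | z ^ p = 1. \<Sum>i<p. (1 / z) ^ i * (N * M ^\<^sub>m i) $$ (a, b)) / of_nat p"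
    by (simp add: mult_root_proj[OF M N ab] sum_divide_distrib)
  also have "(\<Sum>z | z ^ p = 1. \<Sum>i<p. (1 / z) ^ i * (N * M ^\<^sub>m i) $$ (a, b))
    = (\<Sum>i<p. (\<Sum>z | z ^ p = 1. (1 / z) ^ i) * (N * M ^\<^sub>m i) $$ (a, b))"
    by (subst sum.swap) (simp add: sum_distrib_right)
  also have "\<dots> = (\<Sum>i<p. if i = 0 then of_nat p * N $$ (a, b) else 0)"
  proof (rule sum.cong[OF refl])
    fix i assume "i \<in> {..<p}"
    then show "(\<Sum>z | z ^ p = 1. (1 / z) ^ i) * (N * M ^\<^sub>m i) $$ (a, b)
      = (if i = 0 then of_nat p * N $$ (a, b) else 0)"
      using sum_roots_unity_power[of i p] \<open>0 < p\<close> M N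
      by (auto simp: card_roots_unity_eq)
  qed
  also have "\<dots> = of_nat p * N $$ (a, b)"
    using \<open>0 < p\<close> by (simp add: sum.delta)
  finally show ?thesis using \<open>0 < p\<close> by simp
qed

section \<open>Common eigenvectors and simultaneous diagonalization\<close>

text \<open>The projection \<open>F\<close> is cut down by one matrix of \<open>T\<close> at a time,
  multiplying by an eigenprojection that keeps the product nonzero. \<open>S\<close> stays fixed in
  the induction so that the current projection still commutes with the matrices not yet treated.
  \<open>F\<close> confines the search to an invariant subspace.\<close>

lemma common_eigenprojection:
  assumes "finite T" "T \<subseteq> S" and S: "S \<subseteq> carrier_mat n n"
    and comm: "\<And>M N. M \<in> S \<Longrightarrow> N \<in> S \<Longrightarrow> M * N = N * M"
    and Sp: "\<And>M. M \<in> S \<Longrightarrow> M ^\<^sub>m p = 1\<^sub>m n" and p: "0 < p"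
    and F: "F \<in> carrier_mat n n" "F \<noteq> 0\<^sub>m n n" "F * F = F" "\<And>M. M \<in> S \<Longrightarrow> M * F = F * M"
  shows "\<exists>E \<chi>. E \<in> carrier_mat n n \<and> E \<noteq> 0\<^sub>m n n \<and> E * E = E \<and> F * E = E \<and> E * F = E \<and>
    (\<forall>M\<in>S. M * E = E * M) \<and> (\<forall>M\<in>T. M * E = \<chi> M \<cdot>\<^sub>m E \<and> \<chi> M ^ p = (1::complex))"
  using assms(1,2)
proof (induction T rule: finite_induct)
  case empty
  then show ?case using F by (intro exI[of _ F]) auto
next
  case (insert M T)
  then obtain E \<chi> where E: "E \<in> carrier_mat n n" "E \<noteq> 0\<^sub>m n n" "E * E = E" "F * E = E" "E * F = E"
    "\<And>M. M \<in> S \<Longrightarrow> M * E = E * M" and \<chi>: "\<And>M. M \<in> T \<Longrightarrow> M * E = \<chi> M \<cdot>\<^sub>m E \<and> \<chi> M ^ p = 1"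
    by (metis insert_subset)
  have M: "M \<in> S" "M \<in> carrier_mat n n" using insert.prems S by auto
  note assoc = assoc_mult_mat[of _ n n _ n _ n]
  \<comment> \<open>If all these products vanished, completeness of the eigenprojections of
    \<open>M\<close> would give \<open>E = 0\<close>.\<close>
  have "\<exists>z. z ^ p = 1 \<and> E * root_proj p M z \<noteq> 0\<^sub>m n n"
  proof (rule ccontr)
    assume "\<not> ?thesis"
    then have 0: "E * root_proj p M z = 0\<^sub>m n n" if "z ^ p = 1" for z using that by blast
    have "E = 0\<^sub>m n n"
    proof (rule eq_matI)
      fix a b assume "a < dim_row (0\<^sub>m n n :: complex mat)" "b < dim_col (0\<^sub>m n n :: complex mat)"
      then have ab: "a < n" "b < n" by auto
      show "E $$ (a, b) = 0\<^sub>m n n $$ (a, b)"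
        unfolding sum_mult_root_proj[OF M(2) E(1) p ab, symmetric]
        using ab by (intro sum.neutral[THEN trans]) (auto simp: 0)
    qed (use E in auto)
    with E show False by blast
  qed
  then obtain z where z: "z ^ p = 1" and nz: "E * root_proj p M z \<noteq> 0\<^sub>m n n" by blast
  define Q where "Q = root_proj p M z"
  have Q: "Q \<in> carrier_mat n n" using M by (simp add: Q_def)
  have MQ: "M * Q = z \<cdot>\<^sub>m Q" unfolding Q_def by (rule root_proj_eigen[OF M(2) Sp[OF M(1)] z p])
  have QQ: "Q * Q = Q" unfolding Q_def
    by (rule root_proj_fixes[OF M(2) root_proj_carrier[OF M(2)] MQ[unfolded Q_def] z p])
  have commQ: "N * Q = Q * N" if "N \<in> carrier_mat n n" "N * M = M * N" for N
    unfolding Q_def using root_proj_comm[OF M(2)] that by blast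
  have EQ: "E * Q = Q * E" using commQ[OF E(1)] E(6)[OF M(1)] by simp
  have FQ: "F * Q = Q * F" using commQ[OF F(1)] F(4)[OF M(1)] by simp
  \<comment> \<open>The projections \<open>E\<close> and \<open>Q\<close> commute, so their product
    is again a projection.\<close>
  have "E * Q * (E * Q) = E * (Q * E) * Q" using E(1) Q by (simp add: assoc)
  also have "\<dots> = E * E * (Q * Q)" unfolding EQ[symmetric] using E(1) Q by (simp add: assoc)
  finally have "E * Q * (E * Q) = E * Q" using E(3) QQ by simp
  moreover have "F * (E * Q) = E * Q" using E(1,4) F(1) Q by (metis assoc)
  moreover have "E * Q * F = E * Q" using E(1,5) F(1) Q FQ by (metis assoc)
  moreover have "N * (E * Q) = E * Q * N" if "N \<in> S" for N
  proof -
    have N: "N \<in> carrier_mat n n" using that S by auto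
    have "N * (E * Q) = E * (N * Q)" using E(6)[OF that] N E(1) Q by (metis assoc)
    also have "N * Q = Q * N" using commQ[OF N] comm[OF that M(1)] by simp
    finally show ?thesis using N E(1) Q by (simp add: assoc)
  qed
  moreover have "N * (E * Q) = (\<chi>(M := z)) N \<cdot>\<^sub>m (E * Q) \<and> (\<chi>(M := z)) N ^ p = 1"
    if "N \<in> insert M T" for N
  proof (cases "N = M")
    case True
    have "M * (E * Q) = E * (M * Q)" using E(6)[OF M(1)] M E(1) Q by (metis assoc)
    also have "\<dots> = z \<cdot>\<^sub>m (E * Q)" unfolding MQ using E(1) Q by (rule mult_smult_distrib)
    finally show ?thesis using True z by simp
  next
    case False
    then have N: "N \<in> T" "N \<in> carrier_mat n n" using that insert.prems S by auto
    have "N * (E * Q) = (\<chi> N \<cdot>\<^sub>m E) * Q" using \<chi>[OF N(1)] N E(1) Q by (metis assoc)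
    also have "\<dots> = \<chi> N \<cdot>\<^sub>m (E * Q)" using E(1) Q by (rule mult_smult_assoc_mat)
    finally show ?thesis using False \<chi>[OF N(1)] by simp
  qed
  ultimately show ?case using nz E(1) Q
    by (intro exI[of _ "E * Q"] exI[of _ "\<chi>(M := z)"]) (auto simp: Q_def[symmetric])
qed

text \<open>Padding both factors with zeros to square matrices keeps the product. A one-sided
  inverse of a square matrix is two-sided, but in the opposite order the padded product has a zero
  row at index \<open>r\<close>.\<close>

lemma mult_mat_neq_one:
  assumes A: "(A :: 'a :: field mat) \<in> carrier_mat n r" and B: "B \<in> carrier_mat r n" and "r < n"
  shows "A * B \<noteq> 1\<^sub>m n"
proof
  assume AB: "A * B = 1\<^sub>m n"
  define A' where "A' = mat n n (\<lambda>(a, b). if b < r then A $$ (a, b) else 0)"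
  define B' where "B' = mat n n (\<lambda>(a, b). if a < r then B $$ (a, b) else 0)"
  have c: "A' \<in> carrier_mat n n" "B' \<in> carrier_mat n n" by (auto simp: A'_def B'_def)
  have "A' * B' = 1\<^sub>m n"
  proof (rule eq_matI)
    fix a b assume "a < dim_row (1\<^sub>m n :: 'a mat)" "b < dim_col (1\<^sub>m n :: 'a mat)"
    then have ab: "a < n" "b < n" by auto
    have "(A' * B') $$ (a, b) = (\<Sum>k<n. A' $$ (a, k) * B' $$ (k, b))"
      using ab by (rule index_mult_mat_sum[OF c])
    also have "\<dots> = (\<Sum>k<r. A $$ (a, k) * B $$ (k, b))"
      using ab \<open>r < n\<close> by (intro sum.mono_neutral_cong_right) (auto simp: A'_def B'_def)
    also have "\<dots> = (A * B) $$ (a, b)"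
      using ab by (rule index_mult_mat_sum[OF A B, symmetric])
    finally show "(A' * B') $$ (a, b) = 1\<^sub>m n $$ (a, b)" by (simp only: AB)
  qed (use c in auto)
  then have "B' * A' = 1\<^sub>m n" by (rule mat_mult_left_right_inverse[OF c])
  then have "(B' * A') $$ (r, r) = 1" using \<open>r < n\<close> by simp
  moreover have "(B' * A') $$ (r, r) = 0"
    using \<open>r < n\<close> by (subst index_mult_mat_sum[OF c(2,1)]) (auto simp: A'_def B'_def)
  ultimately show False by simp
qed

text \<open>Eigenvectors are added one at a time. The columns of \<open>A\<close> are common
  eigenvectors and the rows of \<open>B\<close> are dual left eigenvectors; carrying both makes
  \<open>A * B\<close> a projection commuting with \<open>S\<close>, so a complement to the vectors
  found so far is available without choosing bases.\<close>

lemma partial_simultaneous_diagonalization: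
  assumes "finite S" and S: "S \<subseteq> carrier_mat n n"
    and comm: "\<And>M N. M \<in> S \<Longrightarrow> N \<in> S \<Longrightarrow> M * N = N * M"
    and Sp: "\<And>M. M \<in> S \<Longrightarrow> M ^\<^sub>m p = 1\<^sub>m n" and p: "0 < p"
    and "r \<le> n"
  shows "\<exists>A B \<chi>. A \<in> carrier_mat n r \<and> B \<in> carrier_mat r n \<and> B * A = 1\<^sub>m r \<and>
    (\<forall>M\<in>S. M * A = A * mat_diag r (\<chi> M) \<and> B * M = mat_diag r (\<chi> M) * B \<and>
      (\<forall>i<r. \<chi> M i ^ p = (1::complex)))"
  using \<open>r \<le> n\<close>
proof (induction r)
  case 0
  show ?case by (intro exI[of _ "0\<^sub>m n 0"] exI[of _ "0\<^sub>m 0 n"] exI[of _ "\<lambda>_ _. 1"])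
      (use S in \<open>auto intro!: eq_matI\<close>)
next
  case (Suc r)
  then obtain A B \<chi> where A: "A \<in> carrier_mat n r" and B: "B \<in> carrier_mat r n"
    and BA: "B * A = 1\<^sub>m r" and MA: "\<And>M. M \<in> S \<Longrightarrow> M * A = A * mat_diag r (\<chi> M)"
    and BM: "\<And>M. M \<in> S \<Longrightarrow> B * M = mat_diag r (\<chi> M) * B"
    and \<chi>: "\<And>M i. M \<in> S \<Longrightarrow> i < r \<Longrightarrow> \<chi> M i ^ p = 1"
    by (metis Suc_leD)
  have D: "mat_diag r d \<in> carrier_mat r r" for d :: "nat \<Rightarrow> complex" by simp
  \<comment> \<open>\<open>F\<close> projects onto the invariant complement of the eigenvectors
    found so far. It is nonzero because \<open>A * B\<close> cannot be the identity while
    \<open>r < n\<close>.\<close>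
  define F where "F = 1\<^sub>m n - A * B"
  have AB: "A * B \<in> carrier_mat n n" using A B by simp
  have F: "F \<in> carrier_mat n n" using AB by (simp add: F_def minus_carrier_mat)
  have F0: "F \<noteq> 0\<^sub>m n n"
  proof
    assume "F = 0\<^sub>m n n"
    then have "F + A * B = 0\<^sub>m n n + A * B" by simp
    then have "A * B = 1\<^sub>m n" using AB unfolding F_def by (auto simp: minus_add_uminus_mat[of _ n n] assoc_add_mat[of _ n n])
    then show False using mult_mat_neq_one[OF A B] Suc.prems by simp
  qed
  have BF: "B * F = 0\<^sub>m r n"
  proof -
    have "B * F = B - B * (A * B)" unfolding F_def
      using A B AB by (simp add: mult_minus_distrib_mat[of _ r n _ n])
    also have "B * (A * B) = B" using A B BA by (metis assoc_mult_mat left_mult_one_mat)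
    finally show ?thesis using B by simp
  qed
  have FA: "F * A = 0\<^sub>m n r"
  proof -
    have "F * A = A - A * B * A" unfolding F_def
      using A B AB by (simp add: minus_mult_distrib_mat[of _ n n _ _ r])
    also have "A * B * A = A" using A B BA by (metis assoc_mult_mat right_mult_one_mat)
    finally show ?thesis using A by simp
  qed
  have FF: "F * F = F"
  proof -
    have "F * F = F * 1\<^sub>m n - F * (A * B)"
      using mult_minus_distrib_mat[OF F one_carrier_mat AB] unfolding F_def[symmetric] .
    also have "F * (A * B) = 0\<^sub>m n n"
      using assoc_mult_mat[OF F A B] B unfolding FA by simp
    also have "F * 1\<^sub>m n - 0\<^sub>m n n = F" using F by (intro eq_matI) auto
    finally show ?thesis .
  qed
  have MF: "M * F = F * M" if "M \<in> S" for M
  proof -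
    have M: "M \<in> carrier_mat n n" using that S by auto
    have "M * (A * B) = A * mat_diag r (\<chi> M) * B" using M A B MA[OF that] by (metis assoc_mult_mat)
    also have "\<dots> = A * B * M" using M A B BM[OF that] D by (metis assoc_mult_mat)
    finally show ?thesis unfolding F_def using M AB
      by (simp add: mult_minus_distrib_mat[of _ n n _ n] minus_mult_distrib_mat[of _ n n _ _ n])
  qed
  obtain E \<psi> where E: "E \<in> carrier_mat n n" "E \<noteq> 0\<^sub>m n n" "E * E = E" "F * E = E" "E * F = E"
    "\<And>M. M \<in> S \<Longrightarrow> M * E = E * M" and \<psi>: "\<And>M. M \<in> S \<Longrightarrow> M * E = \<psi> M \<cdot>\<^sub>m E"
    "\<And>M. M \<in> S \<Longrightarrow> \<psi> M ^ p = 1"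
    using common_eigenprojection[OF \<open>finite S\<close> order.refl S comm Sp p F F0 FF MF] by metis
  obtain j k where jk: "j < n" "k < n" "E $$ (j, k) \<noteq> 0"
    using E(1,2) by (metis eq_matI carrier_matD index_zero_mat)
  have BE: "B * E = 0\<^sub>m r n" using assoc_mult_mat[OF B F E(1)] E(1) unfolding BF E(4) by simp
  have EA: "E * A = 0\<^sub>m n r" using assoc_mult_mat[OF E(1) F A] E(1) unfolding FA E(5) by simp
  \<comment> \<open>Since \<open>M * E = E * M = \<psi> M \<cdot>\<^sub>m E\<close>, every column of
    \<open>E\<close> is an eigenvector and every row a left eigenvector. Column \<open>k\<close> and
    row \<open>j\<close> are taken because \<open>E $$ (j, k) \<noteq> 0\<close>: as
    \<open>E * E = E\<close>, dividing the row by this entry makes their pairing 1. The pairings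
    with the old vectors vanish by \<open>BE\<close> and \<open>EA\<close>.\<close>
  define A' where "A' = mat n (Suc r) (\<lambda>(a, b). if b < r then A $$ (a, b) else E $$ (a, k))"
  define B' where "B' = mat (Suc r) n (\<lambda>(a, b). if a < r then B $$ (a, b) else E $$ (j, b) / E $$ (j, k))"
  define \<chi>' where "\<chi>' M i = (if i < r then \<chi> M i else \<psi> M)" for M i
  have A': "A' \<in> carrier_mat n (Suc r)" and B': "B' \<in> carrier_mat (Suc r) n"
    by (auto simp: A'_def B'_def)
  have "B' * A' = 1\<^sub>m (Suc r)"
  proof (rule eq_matI)
    fix a b assume "a < dim_row (1\<^sub>m (Suc r) :: complex mat)" "b < dim_col (1\<^sub>m (Suc r) :: complex mat)"
    then have ab: "a < Suc r" "b < Suc r" by auto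
    have *: "(B' * A') $$ (a, b) = (\<Sum>l<n. B' $$ (a, l) * A' $$ (l, b))"
      using ab by (rule index_mult_mat_sum[OF B' A'])
    consider "a < r" "b < r" | "a < r" "b = r" | "a = r" "b < r" | "a = r" "b = r"
      using ab by linarith
    then show "(B' * A') $$ (a, b) = 1\<^sub>m (Suc r) $$ (a, b)"
    proof cases
      case 1
      then have "(B' * A') $$ (a, b) = (B * A) $$ (a, b)"
        unfolding * index_mult_mat_sum[OF B A 1] by (intro sum.cong) (auto simp: A'_def B'_def)
      then show ?thesis using 1 BA by simp
    next
      case 2
      then have "(B' * A') $$ (a, b) = (B * E) $$ (a, k)"
        unfolding * index_mult_mat_sum[OF B E(1) 2(1) jk(2)]
        by (intro sum.cong) (auto simp: A'_def B'_def)
      then show ?thesis using 2 BE jk by simp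
    next
      case 3
      then have "(B' * A') $$ (a, b) = (E * A) $$ (j, b) / E $$ (j, k)"
        unfolding * index_mult_mat_sum[OF E(1) A jk(1) 3(2)] sum_divide_distrib
        by (intro sum.cong) (auto simp: A'_def B'_def)
      then show ?thesis using 3 EA jk by simp
    next
      case 4
      then have "(B' * A') $$ (a, b) = (E * E) $$ (j, k) / E $$ (j, k)"
        unfolding * index_mult_mat_sum[OF E(1) E(1) jk(1,2)] sum_divide_distrib
        by (intro sum.cong) (auto simp: A'_def B'_def)
      then show ?thesis using 4 E(3) jk by simp
    qed
  qed (use A' B' in auto)
  moreover have "M * A' = A' * mat_diag (Suc r) (\<chi>' M)" if "M \<in> S" for M
  proof -
    have M: "M \<in> carrier_mat n n" using that S by auto
    have A'D: "A' * mat_diag (Suc r) (\<chi>' M) = mat n (Suc r) (\<lambda>(a, b). A' $$ (a, b) * \<chi>' M b)"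
      by (rule mat_diag_mult_right[OF A'])
    have AD: "M * A = mat n r (\<lambda>(a, b). A $$ (a, b) * \<chi> M b)"
      using MA[OF that] mat_diag_mult_right[OF A] by simp
    show ?thesis unfolding A'D
    proof (rule eq_matI)
      fix a b assume "a < dim_row (mat n (Suc r) (\<lambda>(a, b). A' $$ (a, b) * \<chi>' M b))"
        "b < dim_col (mat n (Suc r) (\<lambda>(a, b). A' $$ (a, b) * \<chi>' M b))"
      then have ab: "a < n" "b < Suc r" by auto
      have *: "(M * A') $$ (a, b) = (\<Sum>l<n. M $$ (a, l) * A' $$ (l, b))"
        using ab by (rule index_mult_mat_sum[OF M A'])
      show "(M * A') $$ (a, b) = mat n (Suc r) (\<lambda>(a, b). A' $$ (a, b) * \<chi>' M b) $$ (a, b)"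
      proof (cases "b < r")
        case True
        have "(M * A') $$ (a, b) = (M * A) $$ (a, b)"
          unfolding * index_mult_mat_sum[OF M A ab(1) True]
          using True by (intro sum.cong) (auto simp: A'_def)
        then show ?thesis unfolding AD using True ab by (simp add: A'_def \<chi>'_def)
      next
        case False
        have "(M * A') $$ (a, b) = (M * E) $$ (a, k)"
          unfolding * index_mult_mat_sum[OF M E(1) ab(1) jk(2)]
          using False ab by (intro sum.cong) (auto simp: A'_def)
        then show ?thesis unfolding \<psi>(1)[OF that] using False ab E(1) jk
          by (simp add: A'_def \<chi>'_def)
      qed
    qed (use M A' in auto)
  qed
  moreover have "B' * M = mat_diag (Suc r) (\<chi>' M) * B'" if "M \<in> S" for M
  proof -
    have M: "M \<in> carrier_mat n n" using that S by auto
    have B'D: "mat_diag (Suc r) (\<chi>' M) * B' = mat (Suc r) n (\<lambda>(a, b). \<chi>' M a * B' $$ (a, b))"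
      by (rule mat_diag_mult_left[OF B'])
    have BD: "B * M = mat r n (\<lambda>(a, b). \<chi> M a * B $$ (a, b))"
      using BM[OF that] mat_diag_mult_left[OF B] by simp
    show ?thesis unfolding B'D
    proof (rule eq_matI)
      fix a b assume "a < dim_row (mat (Suc r) n (\<lambda>(a, b). \<chi>' M a * B' $$ (a, b)))"
        "b < dim_col (mat (Suc r) n (\<lambda>(a, b). \<chi>' M a * B' $$ (a, b)))"
      then have ab: "a < Suc r" "b < n" by auto
      have *: "(B' * M) $$ (a, b) = (\<Sum>l<n. B' $$ (a, l) * M $$ (l, b))"
        using ab by (rule index_mult_mat_sum[OF B' M])
      show "(B' * M) $$ (a, b) = mat (Suc r) n (\<lambda>(a, b). \<chi>' M a * B' $$ (a, b)) $$ (a, b)"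
      proof (cases "a < r")
        case True
        have "(B' * M) $$ (a, b) = (B * M) $$ (a, b)"
          unfolding * index_mult_mat_sum[OF B M True ab(2)]
          using True by (intro sum.cong) (auto simp: B'_def)
        then show ?thesis unfolding BD using True ab by (simp add: B'_def \<chi>'_def)
      next
        case False
        have "(B' * M) $$ (a, b) = (E * M) $$ (j, b) / E $$ (j, k)"
          unfolding * index_mult_mat_sum[OF E(1) M jk(1) ab(2)] sum_divide_distrib
          using False ab by (intro sum.cong) (auto simp: B'_def)
        also have "E * M = \<psi> M \<cdot>\<^sub>m E" using \<psi>(1)[OF that] E(6)[OF that] by simp
        finally show ?thesis using False ab E(1) jk
          by (simp add: B'_def \<chi>'_def)
      qed
    qed (use M B' in auto)
  qed
  moreover have "\<chi>' M i ^ p = 1" if "M \<in> S" "i < Suc r" for M i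
    using that \<chi> \<psi>(2) by (simp add: \<chi>'_def)
  ultimately show ?case using A' B' by blast
qed

section \<open>Groups of prime power order and faithful representations\<close>

text \<open>This is the class equation inside \<open>N\<close>, a union of conjugacy classes of
  prime power size. Were the identity the only central element of \<open>N\<close>, all other
  classes in \<open>N\<close> would have size divisible by \<open>p\<close>, whence
  \<open>card N\<close> would be 1 modulo \<open>p\<close>, although \<open>p\<close> divides
  it.\<close>

lemma (in group) normal_p_subgroup_meets_center:
  assumes p: "prime p" and ord: "Coset.order G = p ^ k" and N: "N \<lhd> G" and N1: "N \<noteq> {\<one>}"
  obtains z where "z \<in> N" "z \<noteq> \<one>" "z [^] p = \<one>" "\<And>g. g \<in> carrier G \<Longrightarrow> g \<otimes> z = z \<otimes> g"
proof -
  have fin: "finite (carrier G)"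
    using ord prime_gt_0_nat[OF p] by (intro card_ge_0_finite) (simp add: Coset.order_def)
  have sub: "subgroup N G" using N by (rule normal_imp_subgroup)
  have NG: "N \<subseteq> carrier G" and N_one: "\<one> \<in> N"
    using sub subgroup.subset subgroup.one_closed by auto
  let ?c = "\<lambda>g. \<lambda>h \<in> carrier G. g \<otimes> h \<otimes> inv g"
  interpret act: group_action G "carrier G" ?c by (rule action_by_conjugation)
  have orb: "orbit G ?c x = (\<lambda>g. g \<otimes> x \<otimes> inv g) ` carrier G" if "x \<in> carrier G" for x
    using that by (auto simp: orbit_def)
  have card_orb: "\<exists>j. card (orbit G ?c x) = p ^ j" if "x \<in> carrier G" for x
  proof -
    have "card (orbit G ?c x) dvd p ^ k"
      using act.orbit_stabilizer_theorem[OF that] unfolding ord by (rule dvdI[OF sym])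
    then show ?thesis using divides_primepow_nat[OF p] by auto
  qed
  have orbN: "orbit G ?c x \<subseteq> N" if "x \<in> N" for x
    using that NG N by (auto simp: orb subset_iff intro!: normal.inv_op_closed2)
  have self: "x \<in> orbit G ?c x" if "x \<in> carrier G" for x
    using that act.orbit_refl by blast
  have "\<exists>w\<in>N. w \<noteq> \<one> \<and> (\<forall>g\<in>carrier G. g \<otimes> w \<otimes> inv g = w)"
  proof (rule ccontr)
    assume none: "\<not> ?thesis"
    define O' where "O' = orbits G (carrier G) ?c"
    \<comment> \<open>The weight is the indicator of \<open>N\<close>, so that summing over all
      conjugacy classes of the group counts \<open>N\<close>; classes outside \<open>N\<close>
      contribute 0.\<close>
    define w where "w = (\<lambda>x. if x \<in> N then 1 else 0 :: nat)"
    have part: "(\<Sum>o'\<in>O'. \<Sum>x\<in>o'. w x) = card N"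
    proof -
      have "(\<Sum>o'\<in>O'. \<Sum>x\<in>o'. w x) = (\<Sum>x\<in>carrier G. w x)"
        unfolding O'_def by (rule act.disjoint_sum[OF fin])
      also have "\<dots> = card N"
        using NG fin by (simp add: w_def sum.If_cases Int_absorb1)
      finally show ?thesis .
    qed
    have orb1: "orbit G ?c \<one> = {\<one>}" by (auto simp: orb)
    have O1: "{\<one>} \<in> O'" unfolding O'_def orbits_def using orb1 by auto
    have finO: "finite O'" unfolding O'_def orbits_def using fin by auto
    have dvd: "p dvd (\<Sum>x\<in>o'. w x)" if o': "o' \<in> O' - {{\<one>}}" for o'
    proof -
      obtain x where x: "x \<in> carrier G" "o' = orbit G ?c x" "o' \<noteq> {\<one>}"
        using o' unfolding O'_def orbits_def by auto
      show ?thesis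
      proof (cases "x \<in> N")
        case False
        have "y \<notin> N" if "y \<in> o'" for y
        proof
          assume "y \<in> N"
          moreover have "x \<in> orbit G ?c y"
            using act.orbit_sym[OF x(1) _ , of y] that x(2) \<open>y \<in> N\<close> NG by blast
          ultimately show False using False orbN by blast
        qed
        then show ?thesis by (simp add: w_def)
      next
        case True
        have "x \<noteq> \<one>" using x orb1 by auto
        then obtain g where g: "g \<in> carrier G" "g \<otimes> x \<otimes> inv g \<noteq> x" using none True by blast
        have fino: "finite o'" using x fin by (simp add: orb)
        have "{x, g \<otimes> x \<otimes> inv g} \<subseteq> o'" using x g self by (auto simp: orb)
        then have "card {x, g \<otimes> x \<otimes> inv g} \<le> card o'" by (rule card_mono[OF fino])
        then have "card o' \<noteq> 1" using g(2) by (simp add: card_insert_if)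
        moreover obtain i where "card o' = p ^ i" using card_orb[OF x(1)] x(2) by auto
        ultimately have "p dvd card o'" by (cases i) auto
        moreover have "(\<Sum>x\<in>o'. w x) = card o'"
          using orbN[OF True] x(2) by (simp add: w_def subset_iff)
        ultimately show ?thesis by simp
      qed
    qed
    have "card N = 1 + (\<Sum>o'\<in>O' - {{\<one>}}. \<Sum>x\<in>o'. w x)"
      using part sum.remove[OF finO O1, of "\<lambda>o'. \<Sum>x\<in>o'. w x"] N_one by (simp add: w_def)
    moreover have "p dvd (\<Sum>o'\<in>O' - {{\<one>}}. \<Sum>x\<in>o'. w x)"
      using dvd by (rule dvd_sum)
    moreover have "p dvd card N"
    proof -
      have "card N dvd p ^ k" using lagrange[OF sub] unfolding ord by (metis dvd_triv_right)
      then obtain j where j: "card N = p ^ j" using divides_primepow_nat[OF p] by auto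
      have "j \<noteq> 0"
      proof
        assume "j = 0"
        then have "card N = 1" using j by simp
        then show False using N1 N_one by (metis card_1_singletonE singletonD)
      qed
      then show ?thesis using j by simp
    qed
    ultimately have "p dvd 1" by (metis dvd_add_left_iff)
    then show False using p by simp
  qed
  then obtain w where w: "w \<in> N" "w \<noteq> \<one>" "\<And>g. g \<in> carrier G \<Longrightarrow> g \<otimes> w \<otimes> inv g = w" by blast
  have wG: "w \<in> carrier G" using w NG by auto
  have wcom: "g \<otimes> w = w \<otimes> g" if "g \<in> carrier G" for g
    using w(3)[OF that] wG that by (metis inv_solve_right' m_closed)
  have "ord w dvd p ^ k" using ord_dvd_group_order[OF wG] ord by simp
  then obtain j where j: "ord w = p ^ j" using divides_primepow_nat[OF p] by auto
  have "j \<noteq> 0" using j w(2) ord_eq_1[OF wG] by (cases j) auto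
  then obtain i where i: "j = Suc i" using not0_implies_Suc by blast
  \<comment> \<open>The central element \<open>w\<close> has order \<open>p ^ Suc i\<close>, so its
    power with exponent \<open>p ^ i\<close> has order \<open>p\<close>.\<close>
  show ?thesis
  proof
    show "w [^] (p ^ i) \<in> N"
    proof -
      have "w [^] (m::nat) \<in> N" for m
        by (induction m) (use w(1) N_one subgroup.m_closed[OF sub] in auto)
      then show ?thesis .
    qed
    show "w [^] (p ^ i) \<noteq> \<one>"
    proof
      assume "w [^] (p ^ i) = \<one>"
      then have "p ^ j dvd p ^ i" using pow_eq_id[OF wG] j by simp
      then have "j \<le> i" by (rule power_dvd_imp_le) (rule prime_gt_1_nat[OF p])
      then show False using i by simp
    qed
    show "(w [^] (p ^ i)) [^] p = \<one>"
      using j i wG pow_ord_eq_1[OF wG] by (simp add: nat_pow_pow mult.commute)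
    show "g \<otimes> w [^] (p ^ i) = w [^] (p ^ i) \<otimes> g" if "g \<in> carrier G" for g
    proof -
      have "g \<otimes> w [^] (m::nat) = w [^] m \<otimes> g" for m
      proof (induction m)
        case (Suc m)
        then show ?case using wcom[OF that] wG that by (simp add: m_assoc[symmetric]) (simp add: m_assoc)
      qed (use that in simp)
      then show ?thesis .
    qed
  qed
qed

section \<open>Faithful matrix representations and their existence\<close>

text \<open>Invertibility is automatic: \<open>f (inv g)\<close> is a two-sided inverse of
  \<open>f g\<close>.\<close>

lemma hom_GL_I:
  fixes G (structure)
  assumes "group G" and "\<And>g. g \<in> carrier G \<Longrightarrow> f g \<in> carrier_mat n n" and "f \<one> = 1\<^sub>m n"
    and mult: "\<And>g h. g \<in> carrier G \<Longrightarrow> h \<in> carrier G \<Longrightarrow> f (g \<otimes> h) = f g * f h"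
  shows "f \<in> hom G (GL n)"
proof -
  interpret group G by fact
  have "invertible_mat (f g)" if g: "g \<in> carrier G" for g
  proof -
    have "f g * f (inv g) = 1\<^sub>m n" "f (inv g) * f g = 1\<^sub>m n"
      using g assms(3) mult[of g "inv g"] mult[of "inv g" g] by auto
    then show ?thesis using assms(2)[of g] assms(2)[of "inv g"] g
      by (auto simp: invertible_mat_def inverts_mat_def square_mat.simps)
  qed
  then show ?thesis using assms by (auto simp: hom_def carrier_GL mult_GL)
qed

lemma faithful_rep_I:
  fixes G (structure)
  assumes "group G" and "\<And>g. g \<in> carrier G \<Longrightarrow> f g \<in> carrier_mat n n" and "f \<one> = 1\<^sub>m n"
    and "\<And>g h. g \<in> carrier G \<Longrightarrow> h \<in> carrier G \<Longrightarrow> f (g \<otimes> h) = f g * f h"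
    and ker: "\<And>g. g \<in> carrier G \<Longrightarrow> f g = 1\<^sub>m n \<Longrightarrow> g = \<one>"
  shows "faithful_rep G n f"
proof -
  have "f \<in> hom G (GL n)" using assms(1-4) by (rule hom_GL_I)
  then interpret group_hom G "GL n" f
    using assms(1) group_GL by (simp add: group_hom_def group_hom_axioms_def)
  show ?thesis unfolding faithful_rep_def mon_def
    using \<open>f \<in> hom G (GL n)\<close> ker inj_iff_trivial_ker
    by (auto simp: kernel_def one_GL assms(3))
qed

lemma faithful_rep_D:
  fixes G (structure)
  assumes "group G" and "faithful_rep G n f"
  shows "\<And>g. g \<in> carrier G \<Longrightarrow> f g \<in> carrier_mat n n" and "f \<one> = 1\<^sub>m n"
    and "\<And>g h. g \<in> carrier G \<Longrightarrow> h \<in> carrier G \<Longrightarrow> f (g \<otimes> h) = f g * f h"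
    and "inj_on f (carrier G)"
proof -
  have f: "f \<in> hom G (GL n)" and inj: "inj_on f (carrier G)"
    using assms(2) by (auto simp: faithful_rep_def mon_def)
  interpret group_hom G "GL n" f
    using assms(1) f group_GL by (simp add: group_hom_def group_hom_axioms_def)
  show "\<And>g. g \<in> carrier G \<Longrightarrow> f g \<in> carrier_mat n n" using hom_closed by (auto simp: carrier_GL)
  show "f \<one> = 1\<^sub>m n" using hom_one by (simp add: one_GL)
  show "\<And>g h. g \<in> carrier G \<Longrightarrow> h \<in> carrier G \<Longrightarrow> f (g \<otimes> h) = f g * f h"
    using hom_mult by (simp add: mult_GL)
  show "inj_on f (carrier G)" by (rule inj)
qed

text \<open>The regular representation works. This ensures that the \<open>LEAST\<close> in
  \<open>rep_dim\<close> is attained.\<close>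

lemma faithful_rep_exists:
  fixes G (structure)
  assumes "group G" and fin: "finite (carrier G)"
  shows "\<exists>n \<rho>. faithful_rep G n \<rho>"
proof -
  interpret group G by fact
  define n where "n = card (carrier G)"
  obtain e where e: "bij_betw e {..<n} (carrier G)"
    using fin ex_bij_betw_nat_finite[OF fin] by (auto simp: n_def atLeast0LessThan)
  have eG: "e i \<in> carrier G" if "i < n" for i using e that by (auto simp: bij_betw_def)
  have e_eq: "e i = e j \<longleftrightarrow> i = j" if "i < n" "j < n" for i j
    using e that by (auto simp: bij_betw_def inj_on_def)
  \<comment> \<open>The permutation matrix of left multiplication by \<open>g\<close>, with the
    group elements numbered by \<open>e\<close>.\<close>
  define \<rho> where "\<rho> g = mat n n (\<lambda>(i, j). if e i = g \<otimes> e j then 1 else 0 :: complex)" for g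
  have "faithful_rep G n \<rho>"
  proof (rule faithful_rep_I)
    show "\<rho> g \<in> carrier_mat n n" for g by (simp add: \<rho>_def)
    then have c: "\<rho> g \<in> carrier_mat n n" for g .
    show "\<rho> \<one> = 1\<^sub>m n" by (rule eq_matI) (auto simp: \<rho>_def eG e_eq)
    show "\<rho> (g \<otimes> h) = \<rho> g * \<rho> h" if g: "g \<in> carrier G" and h: "h \<in> carrier G" for g h
    proof (rule eq_matI)
      fix i j assume "i < dim_row (\<rho> g * \<rho> h)" "j < dim_col (\<rho> g * \<rho> h)"
      then have ij: "i < n" "j < n" by (auto simp: \<rho>_def)
      \<comment> \<open>Column \<open>j\<close> of \<open>\<rho> h\<close> has its only nonzero
        entry in row \<open>m\<close>, so the sum for the product reduces to the term
        \<open>k = m\<close>.\<close>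
      obtain m where m: "m < n" "e m = h \<otimes> e j"
        using e h eG[OF ij(2)] by (metis bij_betw_iff_bijections lessThan_iff m_closed)
      have "(\<rho> g * \<rho> h) $$ (i, j) = (\<Sum>k<n. (if e i = g \<otimes> e k then 1 else 0) * (if k = m then 1 else 0))"
        using ij m e_eq
        by (auto simp: scalar_prod_def atLeast0LessThan \<rho>_def m(2)[symmetric] intro!: sum.cong)
      also have "\<dots> = (\<Sum>k<n. if k = m then (if e i = g \<otimes> e m then 1 else 0) else 0)"
        by (intro sum.cong) auto
      also have "\<dots> = (if e i = g \<otimes> e m then 1 else 0)" using m(1) by simp
      also have "\<dots> = \<rho> (g \<otimes> h) $$ (i, j)" using ij m g h eG by (simp add: \<rho>_def m_assoc)
      finally show "\<rho> (g \<otimes> h) $$ (i, j) = (\<rho> g * \<rho> h) $$ (i, j)" by simp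
    qed (auto simp: \<rho>_def)
    show "g = \<one>" if g: "g \<in> carrier G" and 1: "\<rho> g = 1\<^sub>m n" for g
    proof -
      \<comment> \<open>At the index of the identity element, a diagonal entry 1 says that
        \<open>g \<otimes> \<one> = \<one>\<close>.\<close>
      obtain i where i: "i < n" "e i = \<one>"
        using e by (metis bij_betw_iff_bijections lessThan_iff one_closed)
      have "\<rho> g $$ (i, i) = 1" using 1 i by simp
      then show ?thesis using i g by (auto simp: \<rho>_def split: if_splits)
    qed
  qed (rule assms(1))
  then show ?thesis by (intro exI)
qed

lemma rep_dim_le: "faithful_rep G n \<rho> \<Longrightarrow> rep_dim G \<le> n"
  unfolding rep_dim_def by (rule Least_le) (rule exI)

lemma rep_dim_attained:
  fixes G (structure)
  assumes "group G" and "finite (carrier G)"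
  obtains \<rho> where "faithful_rep G (rep_dim G) \<rho>"
proof -
  have "\<exists>\<rho>. faithful_rep G (rep_dim G) \<rho>"
    unfolding rep_dim_def by (rule LeastI_ex) (rule faithful_rep_exists[OF assms])
  then show ?thesis using that by (elim exE)
qed

section \<open>The upper bound\<close>

lemma rep_dim_DirProd_le:
  assumes H: "group H" "finite (carrier H)" and K: "group K" "finite (carrier K)"
  shows "rep_dim (H \<times>\<times> K) \<le> rep_dim H + rep_dim K"
proof -
  obtain \<rho> where \<rho>: "faithful_rep H (rep_dim H) \<rho>" using rep_dim_attained[OF H] .
  obtain \<sigma> where \<sigma>: "faithful_rep K (rep_dim K) \<sigma>" using rep_dim_attained[OF K] .
  note R = faithful_rep_D[OF H(1) \<rho>] and S = faithful_rep_D[OF K(1) \<sigma>]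
  let ?m = "rep_dim H" and ?n = "rep_dim K"
  let ?f = "\<lambda>(h, k). four_block_mat (\<rho> h) (0\<^sub>m ?m ?n) (0\<^sub>m ?n ?m) (\<sigma> k)"
  interpret H: group H by fact
  interpret K: group K by fact
  have "faithful_rep (H \<times>\<times> K) (?m + ?n) ?f"
  proof (rule faithful_rep_I)
    show "group (H \<times>\<times> K)" using H(1) K(1) by (rule DirProd_group)
    show "?f g \<in> carrier_mat (?m + ?n) (?m + ?n)" if "g \<in> carrier (H \<times>\<times> K)" for g
      using that R(1) S(1) by (auto simp: DirProd_def)
    show "?f \<one>\<^bsub>H \<times>\<times> K\<^esub> = 1\<^sub>m (?m + ?n)" using R(2) S(2) by auto
    show "?f (g \<otimes>\<^bsub>H \<times>\<times> K\<^esub> h) = ?f g * ?f h"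
      if "g \<in> carrier (H \<times>\<times> K)" "h \<in> carrier (H \<times>\<times> K)" for g h
    proof -
      obtain a b c d where [simp]: "g = (a, b)" "h = (c, d)" by (cases g, cases h)
      have abcd: "a \<in> carrier H" "b \<in> carrier K" "c \<in> carrier H" "d \<in> carrier K"
        using that by auto
      note c = R(1)[OF abcd(1)] S(1)[OF abcd(2)] R(1)[OF abcd(3)] S(1)[OF abcd(4)]
      show ?thesis
        using c R(3) S(3) abcd
        by (simp add: mult_four_block_mat[OF c(1) zero_carrier_mat zero_carrier_mat c(2) c(3)
            zero_carrier_mat zero_carrier_mat c(4)])
    qed
    show "g = \<one>\<^bsub>H \<times>\<times> K\<^esub>" if g: "g \<in> carrier (H \<times>\<times> K)" and 1: "?f g = 1\<^sub>m (?m + ?n)" for g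
    proof -
      obtain a b where [simp]: "g = (a, b)" by (cases g)
      have ab: "a \<in> carrier H" "b \<in> carrier K" using g by auto
      note c = R(1)[OF ab(1)] S(1)[OF ab(2)]
      \<comment> \<open>Both diagonal blocks are read off from this equation, the second one with
        indices shifted by the size of the first.\<close>
      have entry: "four_block_mat (\<rho> a) (0\<^sub>m ?m ?n) (0\<^sub>m ?n ?m) (\<sigma> b) $$ (i, j) = 1\<^sub>m (?m + ?n) $$ (i, j)" for i j
        using 1 by simp
      have "\<rho> a = \<rho> \<one>\<^bsub>H\<^esub>" unfolding R(2)
      proof (rule eq_matI)
        fix i j assume "i < dim_row (1\<^sub>m ?m :: complex mat)" "j < dim_col (1\<^sub>m ?m :: complex mat)"
        then show "\<rho> a $$ (i, j) = 1\<^sub>m ?m $$ (i, j)" using entry[of i j] c by (auto split: if_splits)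
      qed (use c in auto)
      moreover have "\<sigma> b = \<sigma> \<one>\<^bsub>K\<^esub>" unfolding S(2)
      proof (rule eq_matI)
        fix i j assume "i < dim_row (1\<^sub>m ?n :: complex mat)" "j < dim_col (1\<^sub>m ?n :: complex mat)"
        then show "\<sigma> b $$ (i, j) = 1\<^sub>m ?n $$ (i, j)" using entry[of "?m + i" "?m + j"] c
          by (auto split: if_splits)
      qed (use c in auto)
      ultimately show ?thesis using ab R(4) S(4) by (auto dest: inj_onD)
    qed
  qed
  then show ?thesis by (rule rep_dim_le)
qed

section \<open>Splitting a representation of a direct product\<close>

text \<open>For a \<open>p\<close>-group this is the subgroup usually written Omega_1(Z(G)). Every
  nontrivial normal subgroup of a \<open>p\<close>-group meets it nontrivially, so faithfulness can
  be tested on it.\<close>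

definition central_torsion :: "nat \<Rightarrow> ('a, 'b) monoid_scheme \<Rightarrow> 'a set" where
  "central_torsion p G = {z \<in> carrier G. z [^]\<^bsub>G\<^esub> p = \<one>\<^bsub>G\<^esub> \<and> (\<forall>g\<in>carrier G. g \<otimes>\<^bsub>G\<^esub> z = z \<otimes>\<^bsub>G\<^esub> g)}"

lemma (in group) subgroup_central_torsion: "subgroup (central_torsion p G) G"
proof (rule subgroupI)
  show "central_torsion p G \<subseteq> carrier G" by (auto simp: central_torsion_def)
  show "central_torsion p G \<noteq> {}" by (auto simp: central_torsion_def intro!: exI[of _ \<one>])
next
  fix a assume a: "a \<in> central_torsion p G"
  then have aG: "a \<in> carrier G" by (simp add: central_torsion_def)
  have "g \<otimes> inv a = inv a \<otimes> g" if "g \<in> carrier G" for g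
  proof -
    have "g \<otimes> a = a \<otimes> g" using a that by (simp add: central_torsion_def)
    then have "inv a \<otimes> (g \<otimes> a) \<otimes> inv a = inv a \<otimes> (a \<otimes> g) \<otimes> inv a" by simp
    then have "inv a \<otimes> g \<otimes> (a \<otimes> inv a) = inv a \<otimes> a \<otimes> (g \<otimes> inv a)"
      using aG that by (simp only: m_assoc inv_closed m_closed)
    then show ?thesis using aG that by simp
  qed
  then show "inv a \<in> central_torsion p G"
    using a aG by (simp add: central_torsion_def nat_pow_inv)
next
  fix a b assume ab: "a \<in> central_torsion p G" "b \<in> central_torsion p G"
  then have G: "a \<in> carrier G" "b \<in> carrier G" by (simp_all add: central_torsion_def)
  have "g \<otimes> (a \<otimes> b) = a \<otimes> b \<otimes> g" if g: "g \<in> carrier G" for g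
  proof -
    have "g \<otimes> (a \<otimes> b) = g \<otimes> a \<otimes> b" using G g by (simp add: m_assoc)
    also have "g \<otimes> a = a \<otimes> g" using ab(1) g by (simp add: central_torsion_def)
    also have "a \<otimes> g \<otimes> b = a \<otimes> (g \<otimes> b)" using G g by (simp add: m_assoc)
    also have "g \<otimes> b = b \<otimes> g" using ab(2) g by (simp add: central_torsion_def)
    finally show ?thesis using G g by (simp add: m_assoc)
  qed
  moreover have "(a \<otimes> b) [^] p = \<one>"
  proof -
    have "a \<otimes> b = b \<otimes> a" using ab(2) G by (simp add: central_torsion_def)
    then have "(a \<otimes> b) [^] p = a [^] p \<otimes> b [^] p" using G by (rule pow_mult_distrib)
    moreover have "a [^] p = \<one>" "b [^] p = \<one>"
      using ab unfolding central_torsion_def by blast+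
    ultimately show ?thesis by simp
  qed
  ultimately show "a \<otimes> b \<in> central_torsion p G"
    using G unfolding central_torsion_def by blast
qed

text \<open>The map \<iota> carries \<open>T\<close> into the group on whose central subgroup the
  characters live; it makes one definition serve both factors of the product.\<close>

definition char_kernel :: "nat \<Rightarrow> ('a, 'b) monoid_scheme \<Rightarrow> ('a \<Rightarrow> 'c) \<Rightarrow> ('c \<Rightarrow> complex) set \<Rightarrow> 'a set" where
  "char_kernel p T \<iota> J = {v \<in> central_torsion p T. \<forall>\<phi>\<in>J. \<phi> (\<iota> v) = 1}"

lemma char_kernelD: "v \<in> char_kernel p T \<iota> J \<Longrightarrow> \<phi> \<in> J \<Longrightarrow> \<phi> (\<iota> v) = 1"
  by (simp add: char_kernel_def)

text \<open>The rows of \<open>A\<close> indexed by \<open>I\<close> vanish outside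
  \<open>I\<close>, so in the product only indices from \<open>I\<close> contribute;
  \<open>e\<close> renumbers them.\<close>

lemma reindexed_submatrix_mult:
  assumes A: "A \<in> carrier_mat n n" and B: "B \<in> carrier_mat n n"
    and e: "bij_betw e {..<m} I" and I: "I \<subseteq> {..<n}"
    and zero: "\<And>i k. i \<in> I \<Longrightarrow> k < n \<Longrightarrow> k \<notin> I \<Longrightarrow> A $$ (i, k) = 0"
  shows "mat m m (\<lambda>(a, b). (A * B) $$ (e a, e b))
    = mat m m (\<lambda>(a, b). A $$ (e a, e b)) * (mat m m (\<lambda>(a, b). B $$ (e a, e b)) :: complex mat)"
    (is "?AB = ?A * ?B")
proof (rule eq_matI)
  fix a b assume "a < dim_row (?A * ?B)" "b < dim_col (?A * ?B)"
  then have ab: "a < m" "b < m" by auto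
  have eI: "e a \<in> I" if "a < m" for a using e that by (auto simp: bij_betw_def)
  then have en: "e a < n" "e b < n" using ab I by auto
  have "?AB $$ (a, b) = (\<Sum>k<n. A $$ (e a, k) * B $$ (k, e b))"
    using ab index_mult_mat_sum[OF A B en] by simp
  also have "\<dots> = (\<Sum>k\<in>I. A $$ (e a, k) * B $$ (k, e b))"
    using I zero[OF eI[OF ab(1)]] by (intro sum.mono_neutral_right) auto
  also have "\<dots> = (\<Sum>k<m. A $$ (e a, e k) * B $$ (e k, e b))"
    by (rule sum.reindex_bij_betw[OF e, symmetric])
  also have "\<dots> = (\<Sum>k<m. ?A $$ (a, k) * ?B $$ (k, b))"
    using ab by (intro sum.cong) auto
  also have "\<dots> = (?A * ?B) $$ (a, b)"
    using ab by (intro index_mult_mat_sum[symmetric, of _ m m _ m]) auto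
  finally show "?AB $$ (a, b) = (?A * ?B) $$ (a, b)" .
qed auto

section \<open>Representations that are diagonal on a central subgroup\<close>

text \<open>The setting after a change of basis: \<open>ev i c\<close> is the eigenvalue of the
  central element \<open>c\<close> on the \<open>i\<close>-th basis vector.\<close>

locale diagonalized_rep = group G for G (structure) +
  fixes R :: "'a \<Rightarrow> complex mat" and n :: nat and C :: "'a set" and ev :: "nat \<Rightarrow> 'a \<Rightarrow> complex"
  assumes R_carrier: "g \<in> carrier G \<Longrightarrow> R g \<in> carrier_mat n n"
    and R_one: "R \<one> = 1\<^sub>m n"
    and R_mult: "g \<in> carrier G \<Longrightarrow> h \<in> carrier G \<Longrightarrow> R (g \<otimes> h) = R g * R h"
    and C: "subgroup C G"
    and C_central: "c \<in> C \<Longrightarrow> g \<in> carrier G \<Longrightarrow> g \<otimes> c = c \<otimes> g"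
    and R_diag: "c \<in> C \<Longrightarrow> R c = mat_diag n (\<lambda>i. ev i c)"
begin

text \<open>Restricting to \<open>C\<close> makes two coordinates share a character exactly when
  their eigenvalues agree on \<open>C\<close>, whatever \<open>ev\<close> does elsewhere.\<close>

definition char_at :: "nat \<Rightarrow> 'a \<Rightarrow> complex" where
  "char_at i = restrict (ev i) C"

definition chars :: "('a \<Rightarrow> complex) set" where
  "chars = char_at ` {..<n}"

text \<open>These index the basis of the sum of the eigenspaces for the characters in
  \<open>J\<close>.\<close>

definition coords :: "('a \<Rightarrow> complex) set \<Rightarrow> nat set" where
  "coords J = {i. i < n \<and> char_at i \<in> J}"

lemma C_carrier: "c \<in> C \<Longrightarrow> c \<in> carrier G"
  using subgroup.subset[OF C] by blast

lemma R_diag_index: "c \<in> C \<Longrightarrow> i < n \<Longrightarrow> R c $$ (i, i) = ev i c"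
  by (simp add: R_diag mat_diag_def)

lemma ev_mult:
  assumes "c \<in> C" "d \<in> C" "i < n"
  shows "ev i (c \<otimes> d) = ev i c * ev i d"
proof -
  have cd: "c \<otimes> d \<in> C" using assms subgroup.m_closed[OF C] by blast
  have "R (c \<otimes> d) = mat_diag n (\<lambda>i. ev i c * ev i d)"
    using assms R_mult C_carrier by (simp add: R_diag)
  then show ?thesis using R_diag_index[OF cd assms(3)] assms(3) by (simp add: mat_diag_def)
qed

lemma ev_one: "i < n \<Longrightarrow> ev i \<one> = 1"
  using R_diag_index[of \<one> i] subgroup.one_closed[OF C] by (simp add: R_one)

text \<open>Since \<open>R g\<close> commutes with the diagonal \<open>R c\<close>, its entry at
  \<open>(i, j)\<close> is scaled equally by \<open>ev i c\<close> and \<open>ev j c\<close>; a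
  \<open>c\<close> telling the two characters apart forces it to be 0. Hence the eigenspaces are
  invariant under the whole group.\<close>

lemma R_block:
  assumes g: "g \<in> carrier G" and ij: "i < n" "j < n" and neq: "char_at i \<noteq> char_at j"
  shows "R g $$ (i, j) = 0"
proof -
  obtain c where c: "c \<in> C" "ev i c \<noteq> ev j c"
    using neq unfolding char_at_def by (metis restrict_ext)
  have "R g * R c = R c * R g"
    using R_mult[OF g C_carrier[OF c(1)]] R_mult[OF C_carrier[OF c(1)] g] C_central[OF c(1) g] by simp
  then have "mat n n (\<lambda>(i, j). R g $$ (i, j) * ev j c) = mat n n (\<lambda>(i, j). ev i c * R g $$ (i, j))"
    unfolding R_diag[OF c(1)] mat_diag_mult_right[OF R_carrier[OF g]] mat_diag_mult_left[OF R_carrier[OF g]] .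
  then have "mat n n (\<lambda>(i, j). R g $$ (i, j) * ev j c) $$ (i, j)
    = mat n n (\<lambda>(i, j). ev i c * R g $$ (i, j)) $$ (i, j)" by (rule arg_cong)
  then show ?thesis using ij c(2) by simp
qed

lemma finite_chars: "finite chars"
  by (simp add: chars_def)

text \<open>Each coordinate carries exactly one character, so the two blocks partition the
  basis.\<close>

lemma card_coords: "card (coords J) + card (coords (chars - J)) = n"
proof -
  have "coords J \<union> coords (chars - J) = {..<n}" "coords J \<inter> coords (chars - J) = {}"
    by (auto simp: coords_def chars_def)
  moreover have "finite (coords A)" for A by (simp add: coords_def)
  ultimately show ?thesis by (metis card_Un_disjoint card_lessThan)
qed

lemma char_value_mult:
  assumes "\<phi> \<in> chars" "c \<in> C" "d \<in> C"
  shows "\<phi> (c \<otimes> d) = \<phi> c * \<phi> d"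
  using assms ev_mult subgroup.m_closed[OF C] by (auto simp: chars_def char_at_def)

lemma char_value_one: "\<phi> \<in> chars \<Longrightarrow> \<phi> \<one> = 1"
  using ev_one subgroup.one_closed[OF C] by (auto simp: chars_def char_at_def)

lemma subgroup_char_kernel:
  fixes T (structure)
  assumes T: "group T" and \<iota>: "\<iota> \<in> hom T G" and tors: "\<iota> ` central_torsion p T \<subseteq> C"
    and J: "J \<subseteq> chars"
  shows "subgroup (char_kernel p T \<iota> J) T"
proof -
  interpret T: group T by fact
  interpret \<iota>: group_hom T G \<iota> using \<iota> by unfold_locales
  note ct = T.subgroup_central_torsion[of p]
  have ctT: "v \<in> carrier T" if "v \<in> central_torsion p T" for v
    using that subgroup.subset[OF ct] by blast
  show ?thesis
  proof (rule T.subgroupI)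
    show "char_kernel p T \<iota> J \<subseteq> carrier T" using ctT by (auto simp: char_kernel_def)
    have "\<one>\<^bsub>T\<^esub> \<in> char_kernel p T \<iota> J"
      using subgroup.one_closed[OF ct] J char_value_one \<iota>.hom_one by (auto simp: char_kernel_def)
    then show "char_kernel p T \<iota> J \<noteq> {}" by blast
  next
    fix v assume v: "v \<in> char_kernel p T \<iota> J"
    then have vt: "v \<in> central_torsion p T" by (simp add: char_kernel_def)
    have "\<phi> (\<iota> (inv\<^bsub>T\<^esub> v)) = 1" if "\<phi> \<in> J" for \<phi>
    proof -
      have "\<phi> (\<iota> v \<otimes>\<^bsub>G\<^esub> \<iota> (inv\<^bsub>T\<^esub> v)) = \<phi> (\<iota> v) * \<phi> (\<iota> (inv\<^bsub>T\<^esub> v))"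
        using that J tors vt subgroup.m_inv_closed[OF ct vt] by (intro char_value_mult) auto
      moreover have "\<iota> v \<otimes>\<^bsub>G\<^esub> \<iota> (inv\<^bsub>T\<^esub> v) = \<one>\<^bsub>G\<^esub>"
        using ctT[OF vt] by simp
      moreover have "\<phi> (\<iota> v) = 1" using v that by (rule char_kernelD)
      moreover have "\<phi> \<one>\<^bsub>G\<^esub> = 1" using that J by (intro char_value_one) auto
      ultimately show ?thesis by simp
    qed
    then show "inv\<^bsub>T\<^esub> v \<in> char_kernel p T \<iota> J"
      using subgroup.m_inv_closed[OF ct vt] by (simp add: char_kernel_def)
  next
    fix v w assume vw: "v \<in> char_kernel p T \<iota> J" "w \<in> char_kernel p T \<iota> J"
    then have vwt: "v \<in> central_torsion p T" "w \<in> central_torsion p T" by (simp_all add: char_kernel_def)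
    have "\<phi> (\<iota> (v \<otimes>\<^bsub>T\<^esub> w)) = 1" if "\<phi> \<in> J" for \<phi>
    proof -
      have "\<phi> (\<iota> v \<otimes>\<^bsub>G\<^esub> \<iota> w) = \<phi> (\<iota> v) * \<phi> (\<iota> w)"
        using that J tors vwt by (intro char_value_mult) auto
      then show ?thesis
        using char_kernelD[OF vw(1) that] char_kernelD[OF vw(2) that] ctT vwt by simp
    qed
    then show "v \<otimes>\<^bsub>T\<^esub> w \<in> char_kernel p T \<iota> J"
      using subgroup.m_closed[OF ct vwt] by (simp add: char_kernel_def)
  qed
qed

text \<open>Orders of kernels are powers of \<open>p\<close> by Lagrange. The kernels of
  \<open>A\<close> and \<open>B\<close> intersect in the kernel of \<open>A \<union> B\<close> and
  both lie in that of \<open>A \<inter> B\<close>, so the product count for subgroups gives the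
  inequality between exponents. It is the negated exponent that is submodular.\<close>

lemma char_kernel_submodular:
  fixes T (structure)
  assumes p: "prime p" and T: "finite_p_group p T" and \<iota>: "\<iota> \<in> hom T G"
    and tors: "\<iota> ` central_torsion p T \<subseteq> C"
  obtains k :: "('a \<Rightarrow> complex) set \<Rightarrow> nat"
  where "\<And>J. J \<subseteq> chars \<Longrightarrow> card (char_kernel p T \<iota> J) = p ^ k J"
    and "\<And>A B. A \<subseteq> chars \<Longrightarrow> B \<subseteq> chars \<Longrightarrow> k A + k B \<le> k (A \<union> B) + k (A \<inter> B)"
proof -
  obtain m where gT: "group T" and fin: "finite (carrier T)" and m: "Coset.order T = p ^ m"
    using T by (auto simp: finite_p_group_def)
  interpret T: group T by fact
  note sub = subgroup_char_kernel[OF gT \<iota> tors]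
  have "\<exists>j. card (char_kernel p T \<iota> J) = p ^ j" if "J \<subseteq> chars" for J
  proof -
    have "card (char_kernel p T \<iota> J) dvd p ^ m"
      using T.lagrange[OF sub[OF that]] unfolding m by (metis dvd_triv_right)
    then show ?thesis using divides_primepow_nat[OF p] by auto
  qed
  then obtain k where k: "\<And>J. J \<subseteq> chars \<Longrightarrow> card (char_kernel p T \<iota> J) = p ^ k J" by metis
  have "k A + k B \<le> k (A \<union> B) + k (A \<inter> B)" if AB: "A \<subseteq> chars" "B \<subseteq> chars" for A B
  proof -
    have "finite (char_kernel p T \<iota> (A \<inter> B))"
      using fin subgroup.subset[OF sub] AB by (meson finite_subset le_infI1)
    moreover have "char_kernel p T \<iota> A \<inter> char_kernel p T \<iota> B = char_kernel p T \<iota> (A \<union> B)"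
      by (auto simp: char_kernel_def)
    moreover have "char_kernel p T \<iota> A \<subseteq> char_kernel p T \<iota> (A \<inter> B)"
      "char_kernel p T \<iota> B \<subseteq> char_kernel p T \<iota> (A \<inter> B)"
      by (auto simp: char_kernel_def)
    ultimately have "card (char_kernel p T \<iota> A) * card (char_kernel p T \<iota> B)
        \<le> card (char_kernel p T \<iota> (A \<union> B)) * card (char_kernel p T \<iota> (A \<inter> B))"
      using T.card_mult_subgroups_le[OF sub[OF AB(1)] sub[OF AB(2)] sub[of "A \<inter> B"]] AB by auto
    moreover have "A \<union> B \<subseteq> chars" "A \<inter> B \<subseteq> chars" using AB by auto
    ultimately have "p ^ (k A + k B) \<le> p ^ (k (A \<union> B) + k (A \<inter> B))"
      using AB by (simp add: k power_add)
    then show ?thesis by (rule power_le_imp_le_exp[OF prime_gt_1_nat[OF p]])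
  qed
  with k show ?thesis by (rule that)
qed

text \<open>The block on \<open>coords J\<close> is a subrepresentation. A nontrivial kernel of it
  on \<open>T\<close> would contain a nontrivial central \<open>z\<close> with trivial
  \<open>p\<close>-th power. The matrix of \<open>\<iota> z\<close> is diagonal and its entries in
  the block, the values of the characters in \<open>J\<close>, are all 1; so \<open>z\<close> would
  lie in the common kernel, which is trivial.\<close>

lemma faithful_rep_on_coords:
  fixes T (structure)
  assumes p: "prime p" and T: "finite_p_group p T" and \<iota>: "\<iota> \<in> hom T G"
    and tors: "\<iota> ` central_torsion p T \<subseteq> C"
    and J: "J \<subseteq> chars" and ker: "char_kernel p T \<iota> J = {\<one>\<^bsub>T\<^esub>}"
  shows "\<exists>\<sigma>. faithful_rep T (card (coords J)) \<sigma>"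
proof -
  obtain k where gT: "group T" and k: "Coset.order T = p ^ k"
    using T by (auto simp: finite_p_group_def)
  interpret T: group T by fact
  interpret \<iota>: group_hom T G \<iota> using \<iota> by unfold_locales
  define m where "m = card (coords J)"
  have coords: "coords J \<subseteq> {..<n}" by (auto simp: coords_def)
  then have "finite (coords J)" using finite_subset by blast
  then obtain e where e: "bij_betw e {..<m} (coords J)"
    using ex_bij_betw_nat_finite by (metis m_def atLeast0LessThan)
  have e_coords: "e a \<in> coords J" if "a < m" for a using e that by (auto simp: bij_betw_def)
  then have e_n: "e a < n" if "a < m" for a using coords that by auto
  have e_eq: "e a = e b \<longleftrightarrow> a = b" if "a < m" "b < m" for a b
    using e that by (auto simp: bij_betw_def inj_on_def)
  define \<sigma> where "\<sigma> t = mat m m (\<lambda>(a, b). R (\<iota> t) $$ (e a, e b))" for t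
  have \<sigma>_carrier: "\<sigma> t \<in> carrier_mat m m" for t by (simp add: \<sigma>_def)
  have \<sigma>_one: "\<sigma> \<one>\<^bsub>T\<^esub> = 1\<^sub>m m"
    by (rule eq_matI) (auto simp: \<sigma>_def R_one e_n e_eq)
  have \<sigma>_mult: "\<sigma> (s \<otimes>\<^bsub>T\<^esub> t) = \<sigma> s * \<sigma> t" if st: "s \<in> carrier T" "t \<in> carrier T" for s t
  proof -
    have c: "\<iota> s \<in> carrier G" "\<iota> t \<in> carrier G" using st by auto
    \<comment> \<open>Membership in \<open>coords J\<close> depends only on the character, so
      indices inside and outside have different characters.\<close>
    have "R (\<iota> s) $$ (i, j) = 0" if "i \<in> coords J" "j < n" "j \<notin> coords J" for i j
      using that by (intro R_block[OF c(1)]) (auto simp: coords_def)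
    then show ?thesis
      unfolding \<sigma>_def \<iota>.hom_mult[OF st] R_mult[OF c]
      by (intro reindexed_submatrix_mult[OF R_carrier[OF c(1)] R_carrier[OF c(2)] e coords])
  qed
  have "\<sigma> \<in> hom T (GL m)" using \<sigma>_carrier \<sigma>_one \<sigma>_mult by (intro hom_GL_I[OF gT])
  then interpret \<sigma>: group_hom T "GL m" \<sigma>
    using group_GL by (simp add: group_hom_def group_hom_axioms_def gT)
  have "kernel T (GL m) \<sigma> = {\<one>\<^bsub>T\<^esub>}"
  proof (rule ccontr)
    assume "kernel T (GL m) \<sigma> \<noteq> {\<one>\<^bsub>T\<^esub>}"
    then obtain z where z: "z \<in> kernel T (GL m) \<sigma>" "z \<noteq> \<one>\<^bsub>T\<^esub>" "z [^]\<^bsub>T\<^esub> p = \<one>\<^bsub>T\<^esub>"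
      "\<And>g. g \<in> carrier T \<Longrightarrow> g \<otimes>\<^bsub>T\<^esub> z = z \<otimes>\<^bsub>T\<^esub> g"
      using T.normal_p_subgroup_meets_center[OF p k \<sigma>.normal_kernel] by metis
    have z\<sigma>: "z \<in> carrier T" "\<sigma> z = 1\<^sub>m m" using z(1) by (auto simp: kernel_def one_GL)
    have zt: "z \<in> central_torsion p T" using z z\<sigma> by (simp add: central_torsion_def)
    then have zC: "\<iota> z \<in> C" using tors by blast
    have "\<phi> (\<iota> z) = 1" if \<phi>: "\<phi> \<in> J" for \<phi>
    proof -
      obtain i where i: "i < n" "\<phi> = char_at i" using \<phi> J by (auto simp: chars_def)
      then have "i \<in> coords J" using \<phi> by (simp add: coords_def)
      then obtain a where a: "a < m" "e a = i"
        using bij_betw_imp_surj_on[OF e] by (metis imageE lessThan_iff)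
      have "\<sigma> z $$ (a, a) = 1" using z\<sigma> a by simp
      then show ?thesis using a i zC R_diag_index by (simp add: \<sigma>_def char_at_def)
    qed
    then have "z \<in> char_kernel p T \<iota> J" using zt by (simp add: char_kernel_def)
    then show False using ker z(2) by simp
  qed
  then have "faithful_rep T m \<sigma>"
    using \<sigma>_carrier \<sigma>_one \<sigma>_mult by (intro faithful_rep_I[OF gT]) (auto simp: kernel_def one_GL)
  then show ?thesis unfolding m_def by (intro exI)
qed

end

section \<open>The lower bound\<close>

lemma DirProd_nat_pow: "(x, y) [^]\<^bsub>H \<times>\<times> K\<^esub> (i::nat) = (x [^]\<^bsub>H\<^esub> i, y [^]\<^bsub>K\<^esub> i)"
  by (induction i) (simp_all add: nat_pow_def DirProd_def)

lemma rep_dim_DirProd_ge: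
  assumes p: "prime p" and H: "finite_p_group p H" and K: "finite_p_group p K"
    and \<rho>: "faithful_rep (H \<times>\<times> K) n \<rho>"
  shows "rep_dim H + rep_dim K \<le> n"
proof -
  have gH: "group H" and finH: "finite (carrier H)" and gK: "group K" and finK: "finite (carrier K)"
    using H K by (auto simp: finite_p_group_def)
  interpret H: group H by fact
  interpret K: group K by fact
  define G where "G = H \<times>\<times> K"
  interpret G: group G unfolding G_def using gH gK by (rule DirProd_group)
  have \<rho>G: "faithful_rep G n \<rho>" using \<rho> by (simp add: G_def)
  note rep = faithful_rep_D[OF G.group_axioms \<rho>G]
  define U where "U = central_torsion p H"
  define W where "W = central_torsion p K"
  define C where "C = U \<times> W"
  have sU: "subgroup U H" and sW: "subgroup W K"
    unfolding U_def W_def by (rule H.subgroup_central_torsion K.subgroup_central_torsion)+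
  have UH: "U \<subseteq> carrier H" and WK: "W \<subseteq> carrier K" using sU sW subgroup.subset by auto
  have sC: "subgroup C G" unfolding C_def G_def by (rule DirProd_subgroups[OF gH sU gK sW])
  have CG: "c \<in> carrier G" if "c \<in> C" for c using that subgroup.subset[OF sC] by blast
  have C_central: "g \<otimes>\<^bsub>G\<^esub> c = c \<otimes>\<^bsub>G\<^esub> g" if "c \<in> C" "g \<in> carrier G" for c g
    using that by (auto simp: C_def G_def U_def W_def central_torsion_def)
  have C_tors: "c [^]\<^bsub>G\<^esub> p = \<one>\<^bsub>G\<^esub>" if "c \<in> C" for c
    using that by (auto simp: C_def G_def U_def W_def central_torsion_def DirProd_nat_pow)
  have finC: "finite C" using finite_subset[OF UH finH] finite_subset[OF WK finK] by (simp add: C_def)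
  have \<rho>_pow: "\<rho> (c [^]\<^bsub>G\<^esub> (i::nat)) = \<rho> c ^\<^sub>m i" if "c \<in> carrier G" for c i
    using rep(1)[OF that] that by (induction i) (simp_all add: rep(2,3))
  \<comment> \<open>Partial diagonalization is taken with all \<open>n\<close> vectors, so that
    \<open>A\<close> is a full change of basis with inverse \<open>B\<close>.\<close>
  have "\<exists>A B \<chi>. A \<in> carrier_mat n n \<and> B \<in> carrier_mat n n \<and> B * A = 1\<^sub>m n \<and>
    (\<forall>M\<in>\<rho> ` C. M * A = A * mat_diag n (\<chi> M) \<and> B * M = mat_diag n (\<chi> M) * B \<and>
      (\<forall>i<n. \<chi> M i ^ p = (1::complex)))"
  proof (rule partial_simultaneous_diagonalization)
    show "finite (\<rho> ` C)" using finC by simp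
    show "\<rho> ` C \<subseteq> carrier_mat n n" using rep(1) CG by auto
    show "M * N = N * M" if MN: "M \<in> \<rho> ` C" "N \<in> \<rho> ` C" for M N
    proof -
      obtain c d where "c \<in> C" "d \<in> C" "M = \<rho> c" "N = \<rho> d" using MN by auto
      then show ?thesis using rep(3)[of c d] rep(3)[of d c] CG C_central[of d c] by simp
    qed
    show "M ^\<^sub>m p = 1\<^sub>m n" if "M \<in> \<rho> ` C" for M
      using that CG C_tors \<rho>_pow rep(2) by (metis imageE)
  qed (use prime_gt_0_nat[OF p] in auto)
  then obtain A B \<chi> where A: "A \<in> carrier_mat n n" and B: "B \<in> carrier_mat n n" and BA: "B * A = 1\<^sub>m n"
    and diag: "\<And>c. c \<in> C \<Longrightarrow> B * \<rho> c = mat_diag n (\<chi> (\<rho> c)) * B"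
    and root: "\<And>c i. c \<in> C \<Longrightarrow> i < n \<Longrightarrow> \<chi> (\<rho> c) i ^ p = 1"
    by blast
  have AB: "A * B = 1\<^sub>m n" using mat_mult_left_right_inverse[OF B A BA] .
  define R where "R g = B * \<rho> g * A" for g
  define ev where "ev i c = \<chi> (\<rho> c) i" for i c
  note assoc = assoc_mult_mat[of _ n n _ n _ n]
  have R_mult: "R (g \<otimes>\<^bsub>G\<^esub> h) = R g * R h" if gh: "g \<in> carrier G" "h \<in> carrier G" for g h
  proof -
    note c = rep(1)[OF gh(1)] rep(1)[OF gh(2)]
    have "R g * R h = B * \<rho> g * (A * B) * (\<rho> h * A)"
      unfolding R_def using A B c by (simp add: assoc)
    also have "\<dots> = B * (\<rho> g * \<rho> h) * A" unfolding AB using A B c by (simp add: assoc)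
    finally show ?thesis using rep(3)[OF gh] by (simp add: R_def)
  qed
  have R_diag: "R c = mat_diag n (\<lambda>i. ev i c)" if "c \<in> C" for c
  proof -
    have "R c = mat_diag n (\<chi> (\<rho> c)) * (B * A)"
      unfolding R_def diag[OF that] using A B by (simp add: assoc)
    then show ?thesis unfolding BA ev_def by (simp add: right_mult_one_mat[of _ n n])
  qed
  interpret diagonalized_rep G R n C ev
  proof (intro diagonalized_rep.intro diagonalized_rep_axioms.intro)
    show "R g \<in> carrier_mat n n" if "g \<in> carrier G" for g
      using rep(1)[OF that] A B by (simp add: R_def)
    show "R \<one>\<^bsub>G\<^esub> = 1\<^sub>m n" using A B BA rep(2) by (simp add: R_def)
  qed (use G.group_axioms R_mult sC C_central R_diag in blast)+
  \<comment> \<open>Conjugating back by \<open>A\<close> and \<open>B\<close> recovers \<rho>, so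
    \<open>R\<close> inherits injectivity.\<close>
  have R_inj: "g = h" if gh: "g \<in> carrier G" "h \<in> carrier G" "R g = R h" for g h
  proof -
    have "A * R g * B = \<rho> g" if "g \<in> carrier G" for g
    proof -
      have "A * R g * B = (A * B) * \<rho> g * (A * B)"
        unfolding R_def using A B rep(1)[OF that] by (simp add: assoc)
      then show ?thesis unfolding AB using rep(1)[OF that] by simp
    qed
    then have "\<rho> g = \<rho> h" using gh by metis
    then show ?thesis using rep(4) gh by (auto dest: inj_onD)
  qed
  let ?i = "\<lambda>h. (h, \<one>\<^bsub>K\<^esub>)" and ?j = "\<lambda>k. (\<one>\<^bsub>H\<^esub>, k)"
  have i: "?i \<in> hom H G" and j: "?j \<in> hom K G" by (auto simp: hom_def G_def)
  have U1: "\<one>\<^bsub>H\<^esub> \<in> U" and W1: "\<one>\<^bsub>K\<^esub> \<in> W" using sU sW subgroup.one_closed by auto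
  have iC: "?i ` central_torsion p H \<subseteq> C" and jC: "?j ` central_torsion p K \<subseteq> C"
    using U1 W1 by (auto simp: C_def U_def W_def)
  define kU where "kU = char_kernel p H ?i"
  define kW where "kW = char_kernel p K ?j"
  obtain a where a: "\<And>J. J \<subseteq> chars \<Longrightarrow> card (kU J) = p ^ a J"
    and a_sub: "\<And>A B. A \<subseteq> chars \<Longrightarrow> B \<subseteq> chars \<Longrightarrow> a A + a B \<le> a (A \<union> B) + a (A \<inter> B)"
    using char_kernel_submodular[OF p H i iC] unfolding kU_def by metis
  obtain b where b: "\<And>J. J \<subseteq> chars \<Longrightarrow> card (kW J) = p ^ b J"
    and b_sub: "\<And>A B. A \<subseteq> chars \<Longrightarrow> B \<subseteq> chars \<Longrightarrow> b A + b B \<le> b (A \<union> B) + b (A \<inter> B)"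
    using char_kernel_submodular[OF p K j jC] unfolding kW_def by metis
  have bound: "a A + b A \<le> card (chars - A)" if A: "A \<subseteq> chars" for A
  proof -
    \<comment> \<open>Elements of \<open>C\<close> are separated by their characters, so those on which \<open>A\<close> is trivial
      are determined by the values of the characters outside \<open>A\<close>.\<close>
    let ?E = "chars - A \<rightarrow>\<^sub>E {z::complex. z ^ p = 1}"
    let ?r = "\<lambda>c. restrict (\<lambda>\<phi>. \<phi> c) (chars - A)"
    have p0: "0 < p" by (rule prime_gt_0_nat[OF p])
    have sub: "kU A \<times> kW A \<subseteq> C" by (auto simp: kU_def kW_def char_kernel_def C_def U_def W_def)
    \<comment> \<open>The kernels are taken separately in the two factors; splitting a pair as
      \<open>(u, 1)\<close> times \<open>(1, w)\<close> and using multiplicativity of \<phi> covers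
      their product.\<close>
    have triv: "\<phi> c = 1" if \<phi>: "\<phi> \<in> A" and c: "c \<in> kU A \<times> kW A" for \<phi> c
    proof -
      obtain u w where uw: "c = (u, w)" "u \<in> kU A" "w \<in> kW A" using c by auto
      have "u \<in> U" "w \<in> W" using uw by (auto simp: kU_def kW_def char_kernel_def U_def W_def)
      then have "c = (u, \<one>\<^bsub>K\<^esub>) \<otimes>\<^bsub>G\<^esub> (\<one>\<^bsub>H\<^esub>, w)" "(u, \<one>\<^bsub>K\<^esub>) \<in> C" "(\<one>\<^bsub>H\<^esub>, w) \<in> C"
        using uw UH WK U1 W1 by (auto simp: G_def C_def)
      then have "\<phi> c = \<phi> (u, \<one>\<^bsub>K\<^esub>) * \<phi> (\<one>\<^bsub>H\<^esub>, w)" using char_value_mult \<phi> A by auto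
      moreover have "\<phi> (u, \<one>\<^bsub>K\<^esub>) = 1" "\<phi> (\<one>\<^bsub>H\<^esub>, w) = 1"
        using char_kernelD uw(2,3) \<phi> unfolding kU_def kW_def by fastforce+
      ultimately show ?thesis by simp
    qed
    have "inj_on ?r (kU A \<times> kW A)"
    proof (rule inj_onI)
      fix c d assume cd: "c \<in> kU A \<times> kW A" "d \<in> kU A \<times> kW A" and eq: "?r c = ?r d"
      have cdC: "c \<in> C" "d \<in> C" using cd sub by auto
      have same: "\<phi> c = \<phi> d" if "\<phi> \<in> chars" for \<phi>
      proof (cases "\<phi> \<in> A")
        case True
        then show ?thesis using triv[OF _ cd(1)] triv[OF _ cd(2)] by metis
      next
        case False
        then show ?thesis using fun_cong[OF eq, of \<phi>] that by simp
      qed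
      have "ev i c = ev i d" if "i < n" for i
        using same[of "char_at i"] that cdC by (simp add: chars_def char_at_def)
      then have "R c = R d" unfolding R_diag[OF cdC(1)] R_diag[OF cdC(2)]
        by (intro eq_matI) (auto simp: mat_diag_def)
      then show "c = d" using R_inj CG cdC by blast
    qed
    moreover have "?r ` (kU A \<times> kW A) \<subseteq> ?E"
    proof (rule image_subsetI)
      fix c assume "c \<in> kU A \<times> kW A"
      then have c: "c \<in> C" using sub by blast
      have "\<phi> c ^ p = 1" if "\<phi> \<in> chars" for \<phi>
        using that c root[OF c] by (auto simp: chars_def char_at_def ev_def)
      then show "?r c \<in> ?E" by auto
    qed
    moreover have "finite ?E" using finite_chars p0 by (intro finite_PiE) (auto intro: finite_roots_unity)
    ultimately have "card (kU A \<times> kW A) \<le> card ?E" by (rule card_inj_on_le)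
    \<comment> \<open>Each character outside \<open>A\<close> takes one of the \<open>p\<close>
      values among the \<open>p\<close>-th roots of unity.\<close>
    also have "card ?E = p ^ card (chars - A)"
      using finite_chars by (simp add: card_PiE card_roots_unity_eq[OF p0])
    finally have "p ^ (a A + b A) \<le> p ^ card (chars - A)"
      using a[OF A] b[OF A] by (simp add: card_cartesian_product power_add)
    then show ?thesis by (rule power_le_imp_le_exp[OF prime_gt_1_nat[OF p]])
  qed
  \<comment> \<open>The partition lemma is applied to the negated exponents with
    \<open>d = 0\<close>, its hypothesis being \<open>bound\<close>. As \<open>a\<close> and
    \<open>b\<close> take natural numbers, a nonnegative negated sum forces both exponents to be 0,
    that is, both kernels to be trivial.\<close>
  have "\<exists>J\<subseteq>chars. 0 \<le> - int (a J) + - int (b (chars - J))"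
  proof (rule submodular_partition[OF finite_chars])
    fix A B assume AB: "A \<subseteq> chars" "B \<subseteq> chars"
    show "- int (a (A \<union> B)) + - int (a (A \<inter> B)) \<le> - int (a A) + - int (a B)"
      using a_sub[OF AB] by simp
    show "- int (b (A \<union> B)) + - int (b (A \<inter> B)) \<le> - int (b A) + - int (b B)"
      using b_sub[OF AB] by simp
  next
    fix A assume "A \<subseteq> chars"
    then show "0 \<le> - int (a A) + - int (b A) + int (card (chars - A))"
      using bound[of A] by simp
  qed
  then obtain J where J: "J \<subseteq> chars" "a J = 0" "b (chars - J) = 0" by auto
  have J': "chars - J \<subseteq> chars" by blast
  have "card (kU J) = 1" "card (kW (chars - J)) = 1" using a[OF J(1)] b[OF J'] J by simp_all
  moreover have "\<one>\<^bsub>H\<^esub> \<in> kU J" "\<one>\<^bsub>K\<^esub> \<in> kW (chars - J)"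
    unfolding kU_def kW_def
    using subgroup.one_closed subgroup_char_kernel[OF gH i iC J(1)] subgroup_char_kernel[OF gK j jC J'] by auto
  ultimately have "kU J = {\<one>\<^bsub>H\<^esub>}" "kW (chars - J) = {\<one>\<^bsub>K\<^esub>}"
    by (metis card_1_singletonE singletonD)+
  then obtain \<sigma> \<tau> where "faithful_rep H (card (coords J)) \<sigma>" "faithful_rep K (card (coords (chars - J))) \<tau>"
    using faithful_rep_on_coords[OF p H i iC J(1)] faithful_rep_on_coords[OF p K j jC J']
    unfolding kU_def kW_def by metis
  then have "rep_dim H + rep_dim K \<le> card (coords J) + card (coords (chars - J))"
    by (intro add_mono rep_dim_le)
  then show ?thesis by (simp only: card_coords)
qed

theorem theorem2:
  fixes p :: nat
    and H :: "('a, 'c) monoid_scheme"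
    and K :: "('b, 'd) monoid_scheme"
  assumes "prime p"
    and "finite_p_group p H"
    and "finite_p_group p K"
  shows "rep_dim (H \<times>\<times> K) = rep_dim H + rep_dim K"
proof (rule antisym)
  have HK: "group H" "finite (carrier H)" "group K" "finite (carrier K)"
    using assms by (auto simp: finite_p_group_def)
  then show "rep_dim (H \<times>\<times> K) \<le> rep_dim H + rep_dim K" by (rule rep_dim_DirProd_le)
  have "group (H \<times>\<times> K)" "finite (carrier (H \<times>\<times> K))"
    using HK by (auto simp: DirProd_group)
  then obtain \<rho> where "faithful_rep (H \<times>\<times> K) (rep_dim (H \<times>\<times> K)) \<rho>"
    by (rule rep_dim_attained)
  then show "rep_dim H + rep_dim K \<le> rep_dim (H \<times>\<times> K)"
    by (rule rep_dim_DirProd_ge[OF assms])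
qed

end
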